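(* For any $n\in\mathbb{N}$ (with $n\geq 1$) and $p>n$, there is a continuous function $u\colon\mathbb{R}^n\to\mathbb{R}$ such that $u\in W^{1,p}(\mathbb{R}^n)\subset CH^{p,1-n/p}(\mathbb{R}^n\colon\mathbb{R})$ (elements of $W^{1,p}(\mathbb{R}^n)$ being identified with their continuous representatives in this inclusion), but $u\notin CH_m^{p,1-n/p}(\mathbb{R}^n\colon\mathbb{R})$.
   Context: $\mathbb{R}^n$ carries the Euclidean metric and $W^{1,p}(\mathbb{R}^n)$ is the classical Sobolev space. For $f\colon\mathbb{R}^n\to\mathbb{R}$, $\alpha>0$ and $B\subset\mathbb{R}^n$, put $|f|_{\alpha,B}:=\sup\left\{\frac{|f(x)-f(y)|}{|x-y|^\alpha}: x,y\in B\text{ distinct}\right\}$. For $p,\alpha\in(0,\infty)$, $f\in CH^{p,\alpha}(\mathbb{R}^n\colon\mathbb{R})$ ($f$ is $(p,\alpha)$-compactly Hölder) if for every compact $E\subset\mathbb{R}^n$ and every $\varepsilon\in(0,1)$ there are $r_E>0$ and $C_E>0$ (finite) such that: whenever $\{B_i\}_{i\in I}$, $B_i=B(x_i,r)$, is an at most countable collection of balls with $x_i\in\mathbb{R}^n$ and common radius $r<r_E$ that covers $E$, with $B(x_i,\varepsilon r)\cap B(x_j,\varepsilon r)=\emptyset$ for distinct $i,j\in I$, then $\sum_{i\in I}|f|_{\alpha,B_i}^p\le C_E$. Convention: "covers $E$" includes that every $B_i$ meets $E$; the centers need not lie in $E$. The modified class $CH^{p,\alpha}_m(\mathbb{R}^n\colon\mathbb{R})$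 is defined in the same way but with coverings $B_i=B(x_i,r_i)$ of possibly different radii $r_i<r_E$ satisfying $B(x_i,\varepsilon r_i)\cap B(x_j,\varepsilon r_j)=\emptyset$ for distinct $i,j\in I$. *)

theory Defs
  imports "HOL-Analysis.Analysis"
begin

definition partial_deriv :: "'n::finite \<Rightarrow> (real^'n \<Rightarrow> real) \<Rightarrow> real^'n \<Rightarrow> real" where
  "partial_deriv i f = (\<lambda>x. frechet_derivative f (at x) (axis i 1))"

text \<open>
  Differentiability is demanded before taking partial derivatives, since
  \<^const>\<open>frechet_derivative\<close> is unspecified where no derivative exists.
\<close>

primrec C_class :: "nat \<Rightarrow> (real^'n::finite \<Rightarrow> real) \<Rightarrow> bool" where
  "C_class 0 f \<longleftrightarrow> continuous_on UNIV f"
| "C_class (Suc k) f \<longleftrightarrow> f differentiable_on UNIV \<and> (\<forall>i. C_class k (partial_deriv i f))"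

definition test_function :: "(real^'n::finite \<Rightarrow> real) \<Rightarrow> bool" where
  "test_function \<phi> \<longleftrightarrow> (\<forall>k. C_class k \<phi>) \<and> compact (closure {x. \<phi> x \<noteq> 0})"

definition Lp :: "real \<Rightarrow> (real^'n::finite \<Rightarrow> real) set" where
  "Lp p = {f \<in> borel_measurable lebesgue. integrable lebesgue (\<lambda>x. \<bar>f x\<bar> powr p)}"

definition weak_partial_deriv ::
    "'n::finite \<Rightarrow> (real^'n \<Rightarrow> real) \<Rightarrow> (real^'n \<Rightarrow> real) \<Rightarrow> bool" where
  "weak_partial_deriv i f g \<longleftrightarrow>
     (\<forall>\<phi>. test_function \<phi> \<longrightarrow>
        (LINT x|lebesgue. f x * partial_deriv i \<phi> x) = - (LINT x|lebesgue. g x * \<phi> x))"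

text \<open>
  Elements of \<open>Lp\<close> and \<open>W1p\<close> are functions, not classes modulo null sets; both sets are closed
  under changing a function on a null set. The exponent is meant to satisfy \<open>1 \<le> p\<close>, so that the
  integrals in \<open>weak_partial_deriv\<close> converge.
\<close>

definition W1p :: "real \<Rightarrow> (real^'n::finite \<Rightarrow> real) set" where
  "W1p p = {f \<in> Lp p. \<forall>i. \<exists>g \<in> Lp p. weak_partial_deriv i f g}"

definition continuous_rep :: "(real^'n::finite \<Rightarrow> real) \<Rightarrow> (real^'n \<Rightarrow> real) \<Rightarrow> bool" where
  "continuous_rep f g \<longleftrightarrow> continuous_on UNIV g \<and> (AE x in lebesgue. g x = f x)"

text \<open>
  The seminorm may be infinite, hence its values in \<^typ>\<open>ennreal\<close> and the real power
  \<open>ennreal_rpow\<close> with \<open>\<infinity>\<^sup>p = \<infinity>\<close> (for \<open>p > 0\<close>).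
\<close>

definition holder_seminorm :: "real \<Rightarrow> (real^'n::finite) set \<Rightarrow> (real^'n \<Rightarrow> real) \<Rightarrow> ennreal" where
  "holder_seminorm \<alpha> B f =
     (SUP (x, y) \<in> {(x, y). x \<in> B \<and> y \<in> B \<and> x \<noteq> y}. ennreal (\<bar>f x - f y\<bar> / dist x y powr \<alpha>))"

definition ennreal_rpow :: "ennreal \<Rightarrow> real \<Rightarrow> ennreal" where
  "ennreal_rpow a p = (if a = \<infinity> then \<infinity> else ennreal (enn2real a powr p))"

text \<open>
  At most countable families are indexed by sets of natural numbers. Balls are open. Every ball of a
  covering has to meet the covered set, but its centre need not belong to it.
\<close>

definition ball_cover ::
    "(real^'n::finite) set \<Rightarrow> nat set \<Rightarrow> (nat \<Rightarrow> real^'n) \<Rightarrow> (nat \<Rightarrow> real) \<Rightarrow> bool" where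
  "ball_cover E I x r \<longleftrightarrow>
     E \<subseteq> (\<Union>i\<in>I. ball (x i) (r i)) \<and> (\<forall>i\<in>I. ball (x i) (r i) \<inter> E \<noteq> {})"

definition CH :: "real \<Rightarrow> real \<Rightarrow> (real^'n::finite \<Rightarrow> real) set" where
  "CH p \<alpha> = {f. \<forall>E \<epsilon>. compact E \<and> 0 < \<epsilon> \<and> \<epsilon> < 1 \<longrightarrow>
     (\<exists>r\<^sub>E>0. \<exists>C\<^sub>E>0. \<forall>(I :: nat set) x r.
        0 < r \<and> r < r\<^sub>E \<and> ball_cover E I x (\<lambda>_. r) \<and>
        (\<forall>i\<in>I. \<forall>j\<in>I. i \<noteq> j \<longrightarrow> ball (x i) (\<epsilon> * r) \<inter> ball (x j) (\<epsilon> * r) = {}) \<longrightarrow>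
        (\<Sum>\<^sub>\<infinity>i\<in>I. ennreal_rpow (holder_seminorm \<alpha> (ball (x i) r) f) p) \<le> ennreal C\<^sub>E)}"

definition CH_m :: "real \<Rightarrow> real \<Rightarrow> (real^'n::finite \<Rightarrow> real) set" where
  "CH_m p \<alpha> = {f. \<forall>E \<epsilon>. compact E \<and> 0 < \<epsilon> \<and> \<epsilon> < 1 \<longrightarrow>
     (\<exists>r\<^sub>E>0. \<exists>C\<^sub>E>0. \<forall>(I :: nat set) x r.
        (\<forall>i\<in>I. 0 < r i \<and> r i < r\<^sub>E) \<and> ball_cover E I x r \<and>
        (\<forall>i\<in>I. \<forall>j\<in>I. i \<noteq> j \<longrightarrow> ball (x i) (\<epsilon> * r i) \<inter> ball (x j) (\<epsilon> * r j) = {}) \<longrightarrow>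
        (\<Sum>\<^sub>\<infinity>i\<in>I. ennreal_rpow (holder_seminorm \<alpha> (ball (x i) (r i)) f) p) \<le> ennreal C\<^sub>E)}"

end

theory Submission
  imports Defs
begin

text \<open>
  Two facts have to be established: for \<open>p > n\<close> the continuous representatives of Sobolev functions satisfy the
  condition for coverings by balls of one common radius, and a particular Sobolev function violates it as soon as
  the radii may differ.

  The first fact rests on Morrey's inequality in the localised form
  \<open>\<bar>g x - g y\<bar> \<le> C \<bar>x - y\<bar> powr (1 - n / p) \<parallel>\<nabla>g\<parallel>\<close>, with the \<open>L\<^sup>p\<close> norm taken over the ball around \<open>x\<close>
  that reaches \<open>y\<close> (\<open>morrey_inequality\<close>). Hence the \<open>p\<close>-th power of the Hoelder seminorm on a ball is at most a constant times
  the integral of \<open>\<bar>\<nabla>g\<bar> powr p\<close> over a three times larger ball. Balls of equal radius whose \<open>\<epsilon>\<close>-fold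
  shrinkings are disjoint overlap boundedly often, even after enlargement, so the sum over a covering is at most a constant
  times the total energy (\<open>sum_energy_balls_le\<close>, \<open>weak_gradient_imp_CH\<close>).

  Morrey's inequality is obtained directly from the definition of weak derivatives. Averages of \<open>f\<close> against a smooth
  mollifier are followed while the mollifier is shrunk to a point \<open>x\<close> by homotheties. The density obeys a continuity
  equation whose flux has test functions as components (\<open>moll_kernel_homothety_derivative\<close>), so the derivative of the average is an
  average of the weak gradient (\<open>homothety_derivative\<close>). Hoelder's inequality bounds it by a multiple of
  \<open>t powr (- n / p)\<close>, which is integrable at \<open>0\<close> because \<open>p > n\<close> (\<open>homothety_difference_le\<close>). The same estimate,
  uniform in the centre, makes the mollifications converge uniformly and yields the continuous representative
  (\<open>weak_gradient_continuous_rep\<close>).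

  For the second fact, balls of different radii can have disjoint shrinkings and nevertheless all contain a
  neighbourhood of one point: take centres at distance \<open>(1/8) ^ k\<close> from the origin and radii \<open>2 (1/8) ^ k\<close>. A
  bump concentrated at scale \<open>(1/8) ^ N\<close> around the origin is seen by about \<open>N\<close> of these balls, so it contributes its energy
  about \<open>N\<close> times to the sum over the covering. Adding bumps whose energies are summable, at depths which grow faster
  than the reciprocals of these energies, gives a continuous Sobolev function for which the sums are infinite
  (\<open>spike_sum_weak_gradient\<close>, \<open>spike_sum_notin_CH_m\<close>).
\<close>

section \<open>Calculus of functions with continuous partial derivatives\<close>

lemma partial_deriv_eq:
  "(f has_derivative f') (at x) \<Longrightarrow> partial_deriv i f x = f' (axis i 1)"
  by (metis frechet_derivative_at partial_deriv_def)

lemma C_class_continuous: "C_class k f \<Longrightarrow> continuous_on UNIV f"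
  by (cases k) (auto intro: differentiable_imp_continuous_on)

lemma C_class_SucD: "C_class (Suc k) f \<Longrightarrow> C_class k f"
  by (induction k arbitrary: f)
     (auto intro: differentiable_imp_continuous_on)

lemma has_derivative_frechet:
  "f differentiable_on UNIV \<Longrightarrow> (f has_derivative frechet_derivative f (at x)) (at x)"
  by (simp add: differentiable_on_def frechet_derivative_works)

text \<open>
  Exhibiting the derivative as a concrete function avoids reasoning about
  \<^const>\<open>frechet_derivative\<close>, which is a description.
\<close>

lemma C_class_SucI:
  assumes "\<And>x. (f has_derivative f' x) (at x)"
    and "\<And>i. C_class k (\<lambda>x. f' x (axis i 1))"
  shows "C_class (Suc k) f"
proof -
  have "partial_deriv i f = (\<lambda>x. f' x (axis i 1))" for i
    using assms(1) partial_deriv_eq by blast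
  moreover have "f differentiable_on UNIV"
    using assms(1) by (auto simp: differentiable_on_def differentiable_def)
  ultimately show ?thesis using assms(2) by simp
qed

lemma C_class_const: "C_class k (\<lambda>x. c)"
proof (induction k arbitrary: c)
  case (Suc k)
  show ?case by (rule C_class_SucI[where f' = "\<lambda>_ _. 0"]) (auto simp: Suc)
qed simp

lemma C_class_nth: "C_class k (\<lambda>x :: real^'n::finite. x $ j)"
proof (cases k)
  case 0
  then show ?thesis by (simp add: continuous_on_component)
next
  case (Suc m)
  have "C_class (Suc m) (\<lambda>x :: real^'n. x $ j)"
  proof (rule C_class_SucI[where f' = "\<lambda>_ v. v $ j"])
    show "((\<lambda>x. x $ j) has_derivative (\<lambda>v. v $ j)) (at x)" for x :: "real^'n"
      by (rule bounded_linear_imp_has_derivative) (rule bounded_linear_vec_nth)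
  qed (rule C_class_const)
  then show ?thesis by (simp add: Suc)
qed

lemma C_class_add:
  "C_class k f \<Longrightarrow> C_class k g \<Longrightarrow> C_class k (\<lambda>x. f x + g x)"
proof (induction k arbitrary: f g)
  case 0
  then show ?case by (auto intro: continuous_intros)
next
  case (Suc k)
  show ?case
  proof (rule C_class_SucI)
    show "((\<lambda>x. f x + g x) has_derivative
      (\<lambda>v. frechet_derivative f (at x) v + frechet_derivative g (at x) v)) (at x)" for x
      using Suc.prems by (intro has_derivative_add has_derivative_frechet) auto
    show "C_class k (\<lambda>x. frechet_derivative f (at x) (axis i 1) + frechet_derivative g (at x) (axis i 1))" for i
      using Suc.prems Suc.IH[of "partial_deriv i f" "partial_deriv i g"]
      by (simp add: partial_deriv_def)
  qed
qed

lemma C_class_mult: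
  "C_class k f \<Longrightarrow> C_class k g \<Longrightarrow> C_class k (\<lambda>x. f x * g x)"
proof (induction k arbitrary: f g)
  case 0
  then show ?case by (auto intro: continuous_intros)
next
  case (Suc k)
  show ?case
  proof (rule C_class_SucI)
    show "((\<lambda>x. f x * g x) has_derivative
      (\<lambda>v. f x * frechet_derivative g (at x) v + frechet_derivative f (at x) v * g x)) (at x)" for x
      using Suc.prems by (intro has_derivative_mult has_derivative_frechet) auto
    show "C_class k (\<lambda>x. f x * frechet_derivative g (at x) (axis i 1) +
        frechet_derivative f (at x) (axis i 1) * g x)" for i
      using Suc.prems Suc.IH[of "partial_deriv i f" g] Suc.IH[of f "partial_deriv i g"]
        C_class_SucD[of k f] C_class_SucD[of k g]
      by (intro C_class_add) (auto simp: partial_deriv_def)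
  qed
qed

lemma C_class_sum:
  "(\<And>a. a \<in> A \<Longrightarrow> C_class k (f a)) \<Longrightarrow> C_class k (\<lambda>x. \<Sum>a\<in>A. f a x)"
  by (induction A rule: infinite_finite_induct) (auto intro: C_class_const C_class_add)

lemma has_derivative_affine:
  fixes f :: "real^'n::finite \<Rightarrow> real"
  assumes "f differentiable_on UNIV"
  shows "((\<lambda>y. f (a *\<^sub>R y + b)) has_derivative
           (\<lambda>v. a * frechet_derivative f (at (a *\<^sub>R x + b)) v)) (at x)"
proof -
  have lin: "linear (frechet_derivative f (at (a *\<^sub>R x + b)))"
    by (rule has_derivative_linear[OF has_derivative_frechet[OF assms]])
  have "((\<lambda>y. f (a *\<^sub>R y + b)) has_derivative
           (\<lambda>v. frechet_derivative f (at (a *\<^sub>R x + b)) (a *\<^sub>R v))) (at x)"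
    by (rule has_derivative_compose[OF _ has_derivative_frechet[OF assms]])
       (auto intro!: derivative_eq_intros)
  then show ?thesis using lin by (simp add: linear_scale)
qed

lemma C_class_affine: "C_class k f \<Longrightarrow> C_class k (\<lambda>y. f (a *\<^sub>R y + b))"
proof (induction k arbitrary: f)
  case 0
  then have "continuous_on UNIV f" by simp
  then show ?case
    by (auto intro!: continuous_intros continuous_on_compose2[of UNIV f])
next
  case (Suc k)
  then have d: "f differentiable_on UNIV" by simp
  show ?case
  proof (rule C_class_SucI[OF has_derivative_affine[OF d]])
    show "C_class k (\<lambda>x. a * frechet_derivative f (at (a *\<^sub>R x + b)) (axis i 1))" for i
      using Suc.prems Suc.IH[of "partial_deriv i f"]
      by (intro C_class_mult C_class_const) (auto simp: partial_deriv_def)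
  qed
qed

section \<open>A smooth bump function\<close>

text \<open>
  The functions \<open>exp (-1/t) / t ^ j\<close>, extended by \<open>0\<close> to the left. The whole family is needed because
  it is closed under differentiation up to linear combinations, while \<open>j = 0\<close> alone is not.
\<close>

definition flat :: "nat \<Rightarrow> real \<Rightarrow> real" where
  "flat j t = (if 0 < t then (1 / t) ^ j * exp (- (1 / t)) else 0)"

text \<open>
  A single term of the exponential series at \<open>1/t\<close> gives this; the quadratic decay at \<open>0\<close> is what makes
  the derivative there vanish.
\<close>

lemma flat_le_square: "\<bar>flat j t\<bar> \<le> fact (j + 2) * t\<^sup>2"
proof (cases "0 < t")
  case True
  define w where "w = 1 / t"
  have w: "0 < w" "t = 1 / w" using True by (auto simp: w_def)
  have "(\<Sum>k\<in>{j+2}. w ^ k /\<^sub>R fact k) \<le> exp w"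
    unfolding exp_def using w summable_exp_generic[of w]
    by (intro sum_le_suminf) auto
  then have "w ^ (j + 2) / fact (j + 2) \<le> exp w"
    by (simp add: divide_inverse mult.commute)
  then have "w ^ j * w\<^sup>2 \<le> fact (j + 2) * exp w"
    unfolding power_add[symmetric] by (subst (asm) pos_divide_le_eq) (auto simp: mult.commute)
  then have "w ^ j * exp (- w) \<le> fact (j + 2) * (1 / w)\<^sup>2"
    using w(1) by (simp add: field_simps exp_minus)
  then show ?thesis using w by (simp add: flat_def)
qed (simp add: flat_def)

lemma flat_has_derivative:
  "(flat j has_real_derivative flat (j + 2) t - real j * flat (j + 1) t) (at t)"
proof (cases t "0 :: real" rule: linorder_cases)
  case less
  have "(flat j has_real_derivative 0) (at t) \<longleftrightarrow> ((\<lambda>_. 0) has_real_derivative 0) (at t)"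
    by (rule DERIV_cong_ev)
       (use less in \<open>auto intro!: eventually_nhds_in_open[of "{..<0}", THEN eventually_mono] simp: flat_def\<close>)
  then show ?thesis using less by (simp add: flat_def)
next
  case greater
  have "(flat j has_real_derivative flat (j + 2) t - real j * flat (j + 1) t) (at t) \<longleftrightarrow>
        ((\<lambda>t. (1 / t) ^ j * exp (- (1 / t))) has_real_derivative
           flat (j + 2) t - real j * flat (j + 1) t) (at t)"
    by (rule DERIV_cong_ev)
       (use greater in \<open>auto intro!: eventually_nhds_in_open[of "{0<..}", THEN eventually_mono] simp: flat_def\<close>)
  moreover have "((\<lambda>t. (1 / t) ^ j * exp (- (1 / t))) has_real_derivative
           flat (j + 2) t - real j * flat (j + 1) t) (at t)"
  proof -
    have inv: "((\<lambda>t. 1 / t) has_real_derivative - ((1 / t)\<^sup>2)) (at t)"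
      using greater DERIV_inverse[of t] by (simp add: inverse_eq_divide power2_eq_square)
    have alg: "real j * (- w\<^sup>2 * w ^ (j - Suc 0)) * e + e * - (- w\<^sup>2) * w ^ j =
        w ^ (j + 2) * e - real j * (w ^ (j + 1) * e)" for w e :: real
      by (cases j) (simp_all add: power2_eq_square algebra_simps)
    have "real j * (- (1 / t)\<^sup>2 * (1 / t) ^ (j - Suc 0)) * exp (- (1 / t)) +
        exp (- (1 / t)) * - (- (1 / t)\<^sup>2) * (1 / t) ^ j = flat (j + 2) t - real j * flat (j + 1) t"
      using greater unfolding alg by (simp only: flat_def if_True)
    then show ?thesis
      by (rule DERIV_cong[OF DERIV_mult[OF DERIV_power[OF inv, of j] DERIV_fun_exp[OF DERIV_minus[OF inv]]]])
  qed
  ultimately show ?thesis by blast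
next
  case equal
  have "((\<lambda>h. flat j h / h) \<longlongrightarrow> 0) (at 0)"
  proof (rule Lim_null_comparison)
    show "\<forall>\<^sub>F h in at 0. norm (flat j h / h) \<le> fact (j + 2) * \<bar>h\<bar>"
    proof (rule always_eventually, intro allI)
      fix h :: real
      show "norm (flat j h / h) \<le> fact (j + 2) * \<bar>h\<bar>"
      proof (cases "h = 0")
        case False
        have "\<bar>flat j h\<bar> \<le> (fact (j + 2) * \<bar>h\<bar>) * \<bar>h\<bar>"
          using flat_le_square[of j h] by (simp add: power2_eq_square mult.assoc)
        moreover have "0 < \<bar>h\<bar>" using False by simp
        ultimately have "\<bar>flat j h\<bar> / \<bar>h\<bar> \<le> fact (j + 2) * \<bar>h\<bar>"
          by (simp only: pos_divide_le_eq)
        then show ?thesis by simp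
      qed simp
    qed
    show "((\<lambda>h. fact (j + 2) * \<bar>h\<bar>) \<longlongrightarrow> 0) (at (0::real))"
      by (rule tendsto_eq_intros refl | simp)+
  qed
  then show ?thesis using equal by (simp add: has_field_derivative_iff flat_def)
qed

text \<open>
  By \<open>flat_has_derivative\<close>, differentiating the composition leads back to compositions of the same kind,
  so an induction on the order closes up when all indices \<open>j\<close> are treated at once.
\<close>

lemma C_class_flat: "(\<And>m. C_class m q) \<Longrightarrow> C_class k (\<lambda>x. flat j (q x))"
proof (induction k arbitrary: j)
  case 0
  have "isCont (flat j) t" for t
    using DERIV_isCont flat_has_derivative by blast
  then have "continuous_on UNIV (flat j)" by (simp add: continuous_at_imp_continuous_on)
  then show ?case using 0[of 0] by (auto intro: continuous_on_compose2)
next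
  case (Suc k)
  have d: "q differentiable_on UNIV" using Suc.prems[of 1] by simp
  show ?case
  proof (rule C_class_SucI)
    show "((\<lambda>x. flat j (q x)) has_derivative
       (\<lambda>v. (flat (j + 2) (q x) - real j * flat (j + 1) (q x)) * frechet_derivative q (at x) v)) (at x)" for x
      by (rule has_derivative_compose[OF has_derivative_frechet[OF d]])
         (use flat_has_derivative in \<open>simp add: has_field_derivative_def\<close>)
    have "C_class k (\<lambda>x. flat (j + 2) (q x) + (- real j) * flat (j + 1) (q x))"
      by (intro C_class_add C_class_mult C_class_const Suc.IH Suc.prems)
    moreover have "C_class k (partial_deriv i q)" for i using Suc.prems[of "Suc k"] by simp
    ultimately show "C_class k (\<lambda>x. (flat (j + 2) (q x) - real j * flat (j + 1) (q x)) *
        frechet_derivative q (at x) (axis i 1))" for i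
      using C_class_mult[of k _ "partial_deriv i q"] by (simp add: partial_deriv_def)
  qed
qed

definition bump :: "real^'n::finite \<Rightarrow> real" where
  "bump x = flat 0 (1 - (norm x)\<^sup>2)"

lemma C_class_bump: "C_class k bump"
proof -
  have "C_class m (\<lambda>x :: real^'n. 1 + (-1) * (\<Sum>i\<in>UNIV. x $ i * x $ i))" for m
    by (intro C_class_add C_class_mult C_class_const C_class_sum C_class_nth)
  from C_class_flat[OF this] show ?thesis
    unfolding bump_def by (simp add: norm_vec_def L2_set_def sum_nonneg power2_eq_square)
qed

lemma flat_0_bounds: "0 \<le> flat 0 t" "t \<le> 1 \<Longrightarrow> flat 0 t \<le> exp (-1)"
  by (auto simp: flat_def field_simps)

lemma bump_nonneg: "0 \<le> bump x"
  and bump_le: "bump x \<le> exp (-1)"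
  and bump_0: "bump 0 = exp (-1)"
  by (auto simp: bump_def flat_0_bounds) (simp add: flat_def)

lemma bump_eq_0: "1 \<le> norm x \<Longrightarrow> bump x = 0"
  by (auto simp: bump_def flat_def abs_square_less_1)

lemma bump_pos: "norm x < 1 \<Longrightarrow> 0 < bump x"
  by (simp add: bump_def flat_def power_less_one_iff abs_square_less_1)

section \<open>Integrals depending on a parameter\<close>

lemma tendsto_integral_at:
  fixes s :: "real \<Rightarrow> 'a \<Rightarrow> real"
  assumes meas: "f \<in> borel_measurable M" "\<And>t. t \<in> S \<Longrightarrow> s t \<in> borel_measurable M"
    and w: "integrable M w"
    and lim: "AE x in M. ((\<lambda>t. s t x) \<longlongrightarrow> f x) (at a within S)"
    and bound: "\<And>t. t \<in> S \<Longrightarrow> AE x in M. norm (s t x) \<le> w x"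
  shows "((\<lambda>t. \<integral>x. s t x \<partial>M) \<longlongrightarrow> (\<integral>x. f x \<partial>M)) (at a within S)"
proof (unfold tendsto_at_iff_sequentially, intro allI impI)
  fix X :: "nat \<Rightarrow> real"
  assume X: "\<forall>i. X i \<in> S - {a}" "X \<longlonglongrightarrow> a"
  have "(\<lambda>i. \<integral>x. s (X i) x \<partial>M) \<longlonglongrightarrow> (\<integral>x. f x \<partial>M)"
  proof (rule integral_dominated_convergence[where w = w])
    show "AE x in M. (\<lambda>i. s (X i) x) \<longlonglongrightarrow> f x"
      using lim by eventually_elim
        (use X in \<open>auto simp: tendsto_at_iff_sequentially o_def\<close>)
  qed (use X meas w bound in auto)
  then show "((\<lambda>t. \<integral>x. s t x \<partial>M) \<circ> X) \<longlonglongrightarrow> (\<integral>x. f x \<partial>M)" by (simp add: o_def)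
qed

lemma has_real_derivative_integral:
  fixes K :: "real \<Rightarrow> 'a \<Rightarrow> real"
  assumes t0: "a < t0" "t0 < b"
    and K: "\<And>t. a < t \<Longrightarrow> t < b \<Longrightarrow> integrable M (K t)"
    and deriv: "\<And>t y. a < t \<Longrightarrow> t < b \<Longrightarrow> ((\<lambda>t. K t y) has_real_derivative K' t y) (at t)"
    and bound: "\<And>t y. a < t \<Longrightarrow> t < b \<Longrightarrow> \<bar>K' t y\<bar> \<le> B y"
    and B: "integrable M B" and meas: "K' t0 \<in> borel_measurable M"
  shows "((\<lambda>t. \<integral>y. K t y \<partial>M) has_real_derivative (\<integral>y. K' t0 y \<partial>M)) (at t0)"
proof -
  have "((\<lambda>t. \<integral>y. (K t y - K t0 y) / (t - t0) \<partial>M) \<longlongrightarrow> (\<integral>y. K' t0 y \<partial>M)) (at t0 within {a<..<b})"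
  proof (rule tendsto_integral_at[where w = B])
    show "AE y in M. ((\<lambda>t. (K t y - K t0 y) / (t - t0)) \<longlongrightarrow> K' t0 y) (at t0 within {a<..<b})"
      using deriv[OF t0] by (auto simp: has_field_derivative_iff intro!: AE_I2 intro: tendsto_within_subset)
    show "AE y in M. norm ((K t y - K t0 y) / (t - t0)) \<le> B y" if "t \<in> {a<..<b}" for t
    proof (rule AE_I2)
      fix y
      have "norm (K t y - K t0 y) \<le> B y * norm (t - t0)"
        by (rule field_differentiable_bound[of "{a<..<b}" _ "\<lambda>t. K' t y"])
           (use that t0 deriv bound in \<open>auto intro: has_field_derivative_at_within\<close>)
      moreover have "0 \<le> B y" using bound[of t0 y] t0 by simp
      ultimately show "norm ((K t y - K t0 y) / (t - t0)) \<le> B y"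
        by (cases "t = t0") (auto simp: field_simps)
    qed
  qed (use K[THEN borel_measurable_integrable] t0 B meas in auto)
  then have "((\<lambda>t. \<integral>y. (K t y - K t0 y) / (t - t0) \<partial>M) \<longlongrightarrow> (\<integral>y. K' t0 y \<partial>M)) (at t0)"
    using t0 by (simp add: at_within_open[of t0 "{a<..<b}"])
  moreover have "\<forall>\<^sub>F t in at t0. (\<integral>y. (K t y - K t0 y) / (t - t0) \<partial>M) =
      ((\<integral>y. K t y \<partial>M) - (\<integral>y. K t0 y \<partial>M)) / (t - t0)"
  proof -
    have "\<forall>\<^sub>F t in at t0. t \<in> {a<..<b}"
      using t0 by (intro eventually_at_in_open') auto
    then show ?thesis by eventually_elim (use K t0 in auto)
  qed
  ultimately show ?thesis
    unfolding has_field_derivative_iff by (rule Lim_transform_eventually)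
qed

section \<open>Weak gradients and test functions\<close>

text \<open>
  The Sobolev condition for Borel functions and Lebesgue--Borel measure. Every Sobolev function agrees almost
  everywhere with one of this kind, and Fubini's theorem and changes of variables are then directly applicable.
\<close>

definition weak_gradient :: "real \<Rightarrow> (real^'n::finite \<Rightarrow> real) \<Rightarrow> ('n \<Rightarrow> real^'n \<Rightarrow> real) \<Rightarrow> bool" where
  "weak_gradient p f G \<longleftrightarrow>
     f \<in> borel_measurable borel \<and> integrable lborel (\<lambda>x. \<bar>f x\<bar> powr p) \<and>
     (\<forall>i. G i \<in> borel_measurable borel \<and> integrable lborel (\<lambda>x. \<bar>G i x\<bar> powr p) \<and>
       (\<forall>\<phi>. test_function \<phi> \<longrightarrow>
         (LINT x|lborel. f x * partial_deriv i \<phi> x) = - (LINT x|lborel. G i x * \<phi> x)))"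

lemma test_function_continuous:
  assumes "test_function \<phi>"
  shows "continuous_on UNIV \<phi>" "continuous_on UNIV (partial_deriv i \<phi>)" "\<phi> differentiable_on UNIV"
proof -
  have "C_class (Suc 0) \<phi>" "C_class 0 \<phi>" using assms unfolding test_function_def by blast+
  then show "continuous_on UNIV \<phi>" "continuous_on UNIV (partial_deriv i \<phi>)"
    "\<phi> differentiable_on UNIV" by simp_all
qed

lemma continuous_UNIV_borel :
  "continuous_on UNIV f \<Longrightarrow> f \<in> borel_measurable borel"
  by (rule borel_measurable_continuous_onI)

text \<open>
  Derivatives are local, so supports do not grow under differentiation.
\<close>

lemma partial_deriv_eq_0:
  assumes "open S" "x \<in> S" "\<And>y. y \<in> S \<Longrightarrow> f y = 0"
  shows "partial_deriv i f x = 0"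
proof -
  have "(f has_derivative (\<lambda>_. 0)) (at x)"
    by (rule has_derivative_transform_within_open[of "\<lambda>_. 0" _ _ _ S]) (use assms in auto)
  then show ?thesis by (simp add: partial_deriv_eq)
qed

lemma test_function_support:
  assumes "test_function \<phi>"
  shows "\<exists>R. \<forall>x. R \<le> norm x \<longrightarrow> \<phi> x = 0 \<and> (\<forall>i. partial_deriv i \<phi> x = 0)"
proof -
  have "bounded (closure {x. \<phi> x \<noteq> 0})"
    using assms by (auto simp: test_function_def compact_imp_bounded)
  then obtain B where B: "0 < B" "\<And>x. x \<in> closure {x. \<phi> x \<noteq> 0} \<Longrightarrow> norm x \<le> B"
    unfolding bounded_pos by blast
  have 0: "\<phi> x = 0" if "B < norm x" for x
  proof (rule ccontr)
    assume "\<phi> x \<noteq> 0"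
    then have "x \<in> closure {x. \<phi> x \<noteq> 0}" by (intro subsetD[OF closure_subset]) simp
    then show False using B(2)[of x] that by simp
  qed
  have "partial_deriv i \<phi> x = 0" if "B < norm x" for x i
    by (rule partial_deriv_eq_0[of "- cball 0 B"]) (use that 0 in auto)
  then show ?thesis using 0 by (intro exI[of _ "B + 1"]) auto
qed

lemma continuous_compact_support_bounded:
  fixes f :: "'a::euclidean_space \<Rightarrow> real"
  assumes "continuous_on UNIV f" "\<And>x. R \<le> norm x \<Longrightarrow> f x = 0"
  shows "\<exists>M. \<forall>x. \<bar>f x\<bar> \<le> M"
proof -
  have "bounded (f ` cball 0 R)"
    by (intro compact_imp_bounded compact_continuous_image continuous_on_subset[OF assms(1)]) auto
  then obtain M where "0 < M" "\<And>x. x \<in> cball 0 R \<Longrightarrow> \<bar>f x\<bar> \<le> M"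
    by (auto simp: bounded_pos)
  moreover have "\<bar>f x\<bar> \<le> M" if "x \<notin> cball 0 R" for x
    using assms(2)[of x] that \<open>0 < M\<close> by simp
  ultimately show ?thesis by blast
qed

lemma abs_le_1_plus_powr: "1 \<le> p \<Longrightarrow> \<bar>a\<bar> \<le> 1 + \<bar>a\<bar> powr p" for a :: real
proof (cases "\<bar>a\<bar> \<le> 1")
  case False
  assume "1 \<le> p"
  then have "\<bar>a\<bar> powr 1 \<le> \<bar>a\<bar> powr p" using False by (intro powr_mono) auto
  then show ?thesis by simp
qed (simp add: add_increasing2)

text \<open>
  Functions in \<open>L\<^sup>p\<close> are locally integrable, by \<open>\<bar>a\<bar> \<le> 1 + \<bar>a\<bar> powr p\<close>.
\<close>

lemma integrable_locally_Lp:
  fixes f h :: "'a::euclidean_space \<Rightarrow> real"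
  assumes p: "1 \<le> p" and f: "f \<in> borel_measurable borel" "integrable lborel (\<lambda>x. \<bar>f x\<bar> powr p)"
    and h: "h \<in> borel_measurable borel" "\<And>x. \<bar>h x\<bar> \<le> M" "\<And>x. x \<notin> cball c R \<Longrightarrow> h x = 0"
  shows "integrable lborel (\<lambda>x. f x * h x)"
proof (rule Bochner_Integration.integrable_bound)
  show "integrable lborel (\<lambda>x. M * (indicator (cball c R) x + \<bar>f x\<bar> powr p))"
    using f(2) emeasure_lborel_cball_finite[of c R]
    by (intro integrable_mult_right Bochner_Integration.integrable_add integrable_real_indicator) auto
  have M: "0 \<le> M" using h(2)[of undefined] by linarith
  show "AE x in lborel. norm (f x * h x) \<le> norm (M * (indicator (cball c R) x + \<bar>f x\<bar> powr p))"
  proof (rule AE_I2)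
    fix x
    have "\<bar>f x\<bar> * \<bar>h x\<bar> \<le> (indicator (cball c R) x + \<bar>f x\<bar> powr p) * M"
    proof (cases "x \<in> cball c R")
      case True
      then show ?thesis
        using abs_le_1_plus_powr[OF p, of "f x"] h(2)[of x] M by (intro mult_mono) auto
    qed (use h(3) M in auto)
    then show "norm (f x * h x) \<le> norm (M * (indicator (cball c R) x + \<bar>f x\<bar> powr p))"
      using M by (simp add: abs_mult mult.commute)
  qed
qed (use f h in measurable)

lemma frechet_derivative_eq_partial:
  fixes \<phi> :: "real^'n::finite \<Rightarrow> real"
  assumes "\<phi> differentiable_on UNIV"
  shows "frechet_derivative \<phi> (at x) v = (\<Sum>i\<in>UNIV. v $ i * partial_deriv i \<phi> x)"
proof -
  let ?D = "frechet_derivative \<phi> (at x)"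
  have lin: "linear ?D"
    by (rule has_derivative_linear[OF has_derivative_frechet[OF assms]])
  have "?D v = ?D (\<Sum>i\<in>UNIV. v $ i *\<^sub>R axis i 1)"
    using basis_expansion[of v] by (simp add: scalar_mult_eq_scaleR)
  then show ?thesis
    by (simp add: linear_sum[OF lin] linear_scale[OF lin] partial_deriv_def)
qed

lemma test_functionI:
  fixes \<phi> :: "real^'n::finite \<Rightarrow> real"
  assumes "\<And>k. C_class k \<phi>" "\<And>x. x \<notin> cball c R \<Longrightarrow> \<phi> x = 0"
  shows "test_function \<phi>"
proof -
  have "closure {x. \<phi> x \<noteq> 0} \<subseteq> cball c R"
  proof (rule closure_minimal)
    show "{x. \<phi> x \<noteq> 0} \<subseteq> cball c R" using assms(2) by blast
  qed simp
  then have "compact (closure {x. \<phi> x \<noteq> 0})"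
    by (meson compact_cball compact_eq_bounded_closed bounded_subset closed_closure)
  then show ?thesis using assms(1) by (simp add: test_function_def)
qed

lemma lborel_integral_affine:
  fixes f :: "'a::euclidean_space \<Rightarrow> real" and a :: 'a
  assumes c: "c \<noteq> 0" and [measurable]: "f \<in> borel_measurable borel"
  shows "(\<integral>x. f (a + c *\<^sub>R x) \<partial>lborel) = (\<integral>x. f x \<partial>lborel) / \<bar>c\<bar> ^ DIM('a)"
proof -
  have "(\<integral>x. f x \<partial>lborel) = \<bar>c\<bar> ^ DIM('a) * (\<integral>x. f (a + c *\<^sub>R x) \<partial>lborel)"
    by (subst lborel_affine[OF c, of a])
       (simp add: integral_density integral_distr)
  then show ?thesis using c by simp
qed

section \<open>Mollifiers shrinking along a homothety\<close>

definition mollifier :: "real^'n::finite \<Rightarrow> real" where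
  "mollifier x = bump x / (LINT x|lborel. bump (x :: real^'n))"

lemma continuous_bump: "continuous_on UNIV bump"
  using C_class_continuous[OF C_class_bump] .

lemma integrable_continuous_compact_support:
  fixes f :: "'a::euclidean_space \<Rightarrow> real"
  assumes "continuous_on UNIV f" "\<And>x. x \<notin> cball c R \<Longrightarrow> f x = 0"
  shows "integrable lborel f"
proof -
  have "integrable lborel (\<lambda>x. indicator (cball c R) x *\<^sub>R f x)"
    by (rule borel_integrable_compact) (auto intro: continuous_on_subset[OF assms(1)])
  also have "(\<lambda>x. indicator (cball c R) x *\<^sub>R f x) = f"
    using assms(2) by (auto simp: fun_eq_iff indicator_def)
  finally show ?thesis .
qed

lemma integral_bump_pos: "0 < (LINT x|lborel. bump (x :: real^'n::finite))"
proof -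
  have int: "integrable lborel (bump :: real^'n \<Rightarrow> real)"
    by (rule integrable_continuous_compact_support[OF continuous_bump, of 0 1]) (auto intro: bump_eq_0)
  have "(LINT x|lborel. bump (x :: real^'n)) \<noteq> 0"
  proof
    assume "(LINT x|lborel. bump (x :: real^'n)) = 0"
    then have "AE x in lborel. bump (x :: real^'n) = 0"
      using integral_nonneg_eq_0_iff_AE[OF int] bump_nonneg by auto
    then have "AE x in lborel. (x :: real^'n) \<notin> ball 0 1"
      by eventually_elim (use bump_pos in fastforce)
    then have "emeasure lborel (ball (0 :: real^'n) 1) = 0"
      by (subst (asm) AE_iff_measurable[of "ball 0 1"]) auto
    moreover have "0 < unit_ball_vol (real CARD('n))" by (intro unit_ball_vol_pos) simp
    ultimately show False by (simp add: emeasure_ball)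
  qed
  moreover have "0 \<le> (LINT x|lborel. bump (x :: real^'n))"
    by (intro integral_nonneg_AE) (auto intro: bump_nonneg)
  ultimately show ?thesis by simp
qed

lemma mollifier_nonneg: "0 \<le> mollifier x"
  using integral_bump_pos by (simp add: mollifier_def bump_nonneg less_imp_le)

lemma mollifier_eq_0: "1 \<le> norm x \<Longrightarrow> mollifier x = 0"
  by (simp add: mollifier_def bump_eq_0)

lemma C_class_mollifier: "C_class k mollifier"
  using C_class_mult[OF C_class_bump C_class_const, of k "inverse (LINT x|lborel. bump (x :: real^'n))"]
  by (simp add: mollifier_def[abs_def] divide_inverse)

lemma test_function_mollifier: "test_function mollifier"
  by (rule test_functionI[of _ 0 1]) (auto intro: C_class_mollifier mollifier_eq_0)

lemma continuous_mollifier: "continuous_on UNIV mollifier"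
  using C_class_continuous[OF C_class_mollifier] .

lemma integral_mollifier: "(LINT x|lborel. mollifier (x :: real^'n::finite)) = 1"
  using integral_bump_pos[where 'n='n] by (simp add: mollifier_def)

definition mollifier_bound :: "'n::finite itself \<Rightarrow> real" where
  "mollifier_bound _ = exp (-1) / (LINT x|lborel. bump (x :: real^'n))"

lemma mollifier_le: "mollifier (x :: real^'n::finite) \<le> mollifier_bound TYPE('n)"
  using integral_bump_pos[where 'n='n]
  by (simp add: mollifier_def mollifier_bound_def divide_right_mono bump_le)

lemma mollifier_bound_pos: "0 < mollifier_bound TYPE('n::finite)"
  using integral_bump_pos[where 'n='n] by (simp add: mollifier_bound_def)

definition moll_kernel :: "real^'n::finite \<Rightarrow> real \<Rightarrow> real^'n \<Rightarrow> real" where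
  "moll_kernel a r y = mollifier ((1 / r) *\<^sub>R (y - a)) / r ^ CARD('n)"

lemma moll_kernel_nonneg: "0 < r \<Longrightarrow> 0 \<le> moll_kernel a r y"
  by (simp add: moll_kernel_def mollifier_nonneg)

lemma moll_kernel_eq_0: "0 < r \<Longrightarrow> y \<notin> cball a r \<Longrightarrow> moll_kernel a r y = 0"
  using mollifier_eq_0[of "(1 / r) *\<^sub>R (y - a)"]
  by (simp add: moll_kernel_def dist_norm norm_minus_commute pos_le_divide_eq del: scaleR_conv_of_real)

lemma moll_kernel_le: "0 < r \<Longrightarrow> moll_kernel (a :: real^'n::finite) r y \<le> mollifier_bound TYPE('n) / r ^ CARD('n)"
  by (simp add: moll_kernel_def divide_right_mono mollifier_le)

lemma C_class_moll_kernel: "C_class k (moll_kernel a r)"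
proof -
  have "C_class k (\<lambda>y. mollifier ((1 / r) *\<^sub>R y + - (1 / r) *\<^sub>R a) * (1 / r ^ CARD('n)))" for a :: "real^'n"
    by (intro C_class_mult C_class_const C_class_affine C_class_mollifier)
  then show ?thesis by (simp add: moll_kernel_def[abs_def] scaleR_diff_right)
qed

lemma continuous_on_moll_kernel:
  assumes "continuous_on S a" "continuous_on S y" "0 < r"
  shows "continuous_on S (\<lambda>x. moll_kernel (a x) r (y x))"
  unfolding moll_kernel_def using assms
  by (auto intro!: continuous_intros continuous_on_compose2[OF continuous_mollifier])

lemma integrable_moll_kernel: "0 < r \<Longrightarrow> integrable lborel (moll_kernel a r)"
  by (rule integrable_continuous_compact_support[of _ a r])
     (auto intro!: continuous_on_moll_kernel continuous_intros moll_kernel_eq_0)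

lemma integral_moll_kernel:
  assumes "0 < r"
  shows "(LINT y|lborel. moll_kernel a r (y :: real^'n::finite)) = 1"
    and "(LINT a|lborel. moll_kernel a r (y :: real^'n::finite)) = 1"
proof -
  have [measurable]: "mollifier \<in> borel_measurable (borel :: (real^'n) measure)"
    by (intro continuous_UNIV_borel continuous_mollifier)
  have "(LINT y|lborel. moll_kernel a r (y :: real^'n::finite)) =
      (LINT y|lborel. mollifier (- (1 / r) *\<^sub>R a + (1 / r) *\<^sub>R y)) / r ^ CARD('n)"
    by (simp add: moll_kernel_def scaleR_diff_right)
  also have "\<dots> = 1"
    using assms by (subst lborel_integral_affine) (auto simp: integral_mollifier power_divide)
  finally show "(LINT y|lborel. moll_kernel a r (y :: real^'n::finite)) = 1" .
  have "(LINT a|lborel. moll_kernel a r (y :: real^'n::finite)) =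
      (LINT a|lborel. mollifier ((1 / r) *\<^sub>R y + (- (1 / r)) *\<^sub>R a)) / r ^ CARD('n)"
    by (simp add: moll_kernel_def scaleR_diff_right)
  also have "\<dots> = 1"
    using assms by (subst lborel_integral_affine) (auto simp: integral_mollifier power_divide)
  finally show "(LINT a|lborel. moll_kernel a r (y :: real^'n::finite)) = 1" .
qed

text \<open>
  The components of the velocity field of the homothety centred at \<open>x\<close>, weighted by the mollifier which
  sits at \<open>x + t v\<close> with radius \<open>t s\<close>. Mass moves along this field as \<open>t\<close> varies.
\<close>

definition radial_field :: "real^'n::finite \<Rightarrow> real^'n \<Rightarrow> real \<Rightarrow> real \<Rightarrow> 'n \<Rightarrow> real^'n \<Rightarrow> real" where
  "radial_field x v s t i y = (y - x) $ i / t * moll_kernel (x + t *\<^sub>R v) (t * s) y"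

lemma test_function_radial_field:
  assumes "0 < t" "0 < s"
  shows "test_function (radial_field x v s t i)"
proof (rule test_functionI)
  have "C_class k (\<lambda>y. (1 / t) * (y $ i + - x $ i) * moll_kernel (x + t *\<^sub>R v) (t * s) y)" for k
    by (intro C_class_mult C_class_add C_class_const C_class_nth C_class_moll_kernel)
  then show "C_class k (radial_field x v s t i)" for k
    by (simp add: radial_field_def[abs_def])
  show "radial_field x v s t i y = 0" if "y \<notin> cball (x + t *\<^sub>R v) (t * s)" for y
    using moll_kernel_eq_0[of "t * s" y] that assms by (simp add: radial_field_def)
qed

lemma partial_deriv_radial_field:
  fixes x v y :: "real^'n::finite"
  assumes "0 < t" "0 < s"
  defines "z \<equiv> (1 / (t * s)) *\<^sub>R (y - (x + t *\<^sub>R v))"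
  shows "partial_deriv i (radial_field x v s t i) y =
    (mollifier z + (y - x) $ i * partial_deriv i mollifier z / (t * s)) / (t * (t * s) ^ CARD('n))"
proof -
  have d: "mollifier differentiable_on (UNIV :: (real^'n) set)"
    using test_function_continuous(3)[OF test_function_mollifier] .
  have k: "(moll_kernel (x + t *\<^sub>R v) (t * s) has_derivative
     (\<lambda>h. (1 / (t * s) * frechet_derivative mollifier (at z) h) / (t * s) ^ CARD('n))) (at y)"
    using has_derivative_affine[OF d, of "1 / (t * s)" "- (1 / (t * s)) *\<^sub>R (x + t *\<^sub>R v)" y]
    unfolding moll_kernel_def[abs_def] z_def
    by (intro bounded_linear.has_derivative[OF bounded_linear_divide]) (simp add: scaleR_diff_right)
  have c: "((\<lambda>y. (y - x) $ i / t) has_derivative (\<lambda>h. h $ i / t)) (at y)"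
    by (auto intro!: derivative_eq_intros bounded_linear.has_derivative[OF bounded_linear_vec_nth]
        simp: divide_inverse)
  have "partial_deriv i (radial_field x v s t i) y =
     (y - x) $ i / t * (1 / (t * s) * partial_deriv i mollifier z / (t * s) ^ CARD('n)) +
     axis i (1::real) $ i / t * (mollifier z / (t * s) ^ CARD('n))"
    unfolding radial_field_def[abs_def]
    by (rule partial_deriv_eq[OF has_derivative_mult[OF c k], THEN trans])
       (simp add: partial_deriv_def moll_kernel_def z_def)
  also have "\<dots> = (mollifier z + (y - x) $ i * partial_deriv i mollifier z / (t * s)) / (t * (t * s) ^ CARD('n))"
    using assms(1,2) by (simp add: field_simps)
  finally show ?thesis .
qed

text \<open>
  The continuity equation: a density that is transported has time derivative minus the divergence of its flux.
  This turns a change of scale into an integration by parts.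
\<close>

lemma moll_kernel_homothety_derivative:
  fixes x v y :: "real^'n::finite"
  assumes t: "0 < t" and s: "0 < s"
  shows "((\<lambda>t. moll_kernel (x + t *\<^sub>R v) (t * s) y) has_real_derivative
           - (\<Sum>i\<in>UNIV. partial_deriv i (radial_field x v s t i) y)) (at t)"
proof -
  let ?n = "CARD('n)"
  define z where "z = (\<lambda>t. (1 / (t * s)) *\<^sub>R (y - (x + t *\<^sub>R v)))"
  define D where "D = (\<Sum>i\<in>UNIV. (y - x) $ i * partial_deriv i mollifier (z t))"
  have d: "mollifier differentiable_on (UNIV :: (real^'n) set)"
    using test_function_continuous(3)[OF test_function_mollifier] .
  have zeq: "z t' = (1 / (t' * s)) *\<^sub>R (y - x) - (1 / s) *\<^sub>R v" if "t' \<noteq> 0" for t'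
    using that s by (simp add: z_def algebra_simps)
  have inv: "((\<lambda>t. 1 / (t * s)) has_real_derivative - (1 / (t * (t * s)))) (at t)"
    using t s by (auto intro!: derivative_eq_intros simp: field_simps)
  have "((\<lambda>t. (1 / (t * s)) *\<^sub>R (y - x) - (1 / s) *\<^sub>R v) has_vector_derivative
        (- (1 / (t * (t * s)))) *\<^sub>R (y - x)) (at t)"
    using has_vector_derivative_diff[OF has_vector_derivative_scaleR[OF inv has_vector_derivative_const[of "y - x"]]
        has_vector_derivative_const[of "(1 / s) *\<^sub>R v"]] by simp
  then have z': "(z has_vector_derivative (- (1 / (t * (t * s)))) *\<^sub>R (y - x)) (at t)"
    by (rule has_vector_derivative_transform_within_open[of _ _ _ "{0<..}"]) (use t zeq in auto)
  have m: "((\<lambda>t. mollifier (z t)) has_real_derivative - D / (t * (t * s))) (at t)"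
  proof -
    have "((\<lambda>t. mollifier (z t)) has_derivative
        (\<lambda>h. frechet_derivative mollifier (at (z t)) (h *\<^sub>R ((- (1 / (t * (t * s)))) *\<^sub>R (y - x))))) (at t)"
      by (rule has_derivative_compose[OF z'[unfolded has_vector_derivative_def] has_derivative_frechet[OF d]])
    moreover have "frechet_derivative mollifier (at (z t)) (h *\<^sub>R ((- (1 / (t * (t * s)))) *\<^sub>R (y - x)))
        = - D / (t * (t * s)) * h" for h
      unfolding frechet_derivative_eq_partial[OF d] D_def
      by (simp add: sum_distrib_left sum_distrib_right sum_divide_distrib sum_negf[symmetric] mult_ac)
    ultimately show ?thesis by (simp only: has_field_derivative_def)
  qed
  have p: "((\<lambda>t. (t * s) ^ ?n) has_real_derivative real ?n * (t * s) ^ ?n / t) (at t)"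
  proof -
    have "((\<lambda>t. (t * s) ^ ?n) has_real_derivative real ?n * (s * (t * s) ^ (?n - 1))) (at t)"
      using DERIV_power[of "\<lambda>t. t * s" s t UNIV ?n] by (auto intro!: derivative_eq_intros)
    moreover have "s * (t * s) ^ (?n - 1) = (t * s) ^ ?n / t"
      using t by (simp add: power_eq_if[of "t * s" ?n])
    ultimately show ?thesis by (simp add: mult.commute)
  qed
  have "((\<lambda>t. mollifier (z t) / (t * s) ^ ?n) has_real_derivative
      (- D / (t * (t * s)) * (t * s) ^ ?n - mollifier (z t) * (real ?n * (t * s) ^ ?n / t)) /
        ((t * s) ^ ?n * (t * s) ^ ?n)) (at t)"
    by (rule DERIV_divide[OF m p]) (use t s in auto)
  moreover have "(- D / (t * (t * s)) * (t * s) ^ ?n - mollifier (z t) * (real ?n * (t * s) ^ ?n / t)) /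
        ((t * s) ^ ?n * (t * s) ^ ?n) = - ((real ?n * mollifier (z t) + D / (t * s)) / (t * (t * s) ^ ?n))"
  proof -
    have alg: "(- D / (t * a) * b - m * (n * b / t)) / (b * b) = - ((n * m + D / a) / (t * b))"
      if "a > 0" "b > 0" for a b m n :: real
      using that t by (simp add: field_simps)
    show ?thesis by (rule alg) (use t s in auto)
  qed
  moreover have "(\<Sum>i\<in>UNIV. partial_deriv i (radial_field x v s t i) y) =
      (real ?n * mollifier (z t) + D / (t * s)) / (t * (t * s) ^ ?n)"
    unfolding partial_deriv_radial_field[OF t s] D_def z_def
    by (simp add: sum_divide_distrib[symmetric] sum.distrib)
  moreover have "(\<lambda>t. moll_kernel (x + t *\<^sub>R v) (t * s) y) = (\<lambda>t. mollifier (z t) / (t * s) ^ ?n)"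
    by (simp add: moll_kernel_def z_def)
  ultimately show ?thesis by (simp only:)
qed

lemma integrable_Lp_test:
  assumes p: "1 \<le> p" and f: "f \<in> borel_measurable borel" "integrable lborel (\<lambda>x. \<bar>f x\<bar> powr p)"
    and \<phi>: "test_function \<phi>"
  shows "integrable lborel (\<lambda>x. f x * \<phi> x)" "integrable lborel (\<lambda>x. f x * partial_deriv i \<phi> x)"
proof -
  obtain R where R: "\<And>x. R \<le> norm x \<Longrightarrow> \<phi> x = 0" "\<And>x i. R \<le> norm x \<Longrightarrow> partial_deriv i \<phi> x = 0"
    using test_function_support[OF \<phi>] by auto
  note c = test_function_continuous[OF \<phi>]
  obtain M where M: "\<And>x. \<bar>\<phi> x\<bar> \<le> M"
    using continuous_compact_support_bounded[OF c(1), of R] R(1) by auto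
  obtain M' where M': "\<And>x. \<bar>partial_deriv i \<phi> x\<bar> \<le> M'"
    using continuous_compact_support_bounded[OF c(2)[of i], of R] R(2) by auto
  show "integrable lborel (\<lambda>x. f x * \<phi> x)"
    by (rule integrable_locally_Lp[OF p f continuous_UNIV_borel[OF c(1)] M, of 0 R]) (use R in auto)
  show "integrable lborel (\<lambda>x. f x * partial_deriv i \<phi> x)"
    by (rule integrable_locally_Lp[OF p f continuous_UNIV_borel[OF c(2)] M', of 0 R]) (use R in auto)
qed

lemma integrable_Lp_moll_kernel:
  assumes p: "1 \<le> p" and f: "f \<in> borel_measurable borel" "integrable lborel (\<lambda>x. \<bar>f x\<bar> powr p)"
    and r: "0 < r"
  shows "integrable lborel (\<lambda>y. f y * moll_kernel a r y)"
proof -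
  have "test_function (moll_kernel a r)"
    by (rule test_functionI[of _ a r]) (use r in \<open>auto intro: C_class_moll_kernel moll_kernel_eq_0\<close>)
  then show ?thesis using integrable_Lp_test[OF p f] by blast
qed

text \<open>
  For \<open>t\<close> bounded and bounded away from \<open>0\<close> the divergences are uniformly bounded and supported
  in one fixed ball, which is the domination required for differentiating under the integral.
\<close>

lemma radial_field_divergence_bound:
  fixes x v :: "real^'n::finite"
  assumes a: "0 < a" and s: "0 < s"
  obtains C where "\<And>t y. a < t \<Longrightarrow> t < b \<Longrightarrow>
    \<bar>\<Sum>i\<in>UNIV. partial_deriv i (radial_field x v s t i) y\<bar> \<le> C * indicator (cball x (b * (s + norm v))) y"
proof -
  let ?n = "CARD('n)" and ?H = "mollifier_bound TYPE('n)"
  define \<rho> where "\<rho> = b * (s + norm v)"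
  have "\<exists>M. \<forall>z. \<bar>partial_deriv i mollifier z\<bar> \<le> M" for i :: 'n
  proof -
    obtain R where R: "\<And>(x :: real^'n). R \<le> norm x \<Longrightarrow> partial_deriv i mollifier x = 0"
      using test_function_support[OF test_function_mollifier] by auto
    show ?thesis
      by (rule continuous_compact_support_bounded[OF test_function_continuous(2)[OF test_function_mollifier] R])
  qed
  then obtain M where M: "\<And>i z. \<bar>partial_deriv i mollifier (z :: real^'n)\<bar> \<le> M i" by metis
  then have M0: "0 \<le> M i" for i by (rule order_trans[OF abs_ge_zero])
  define C where "C = (\<Sum>i\<in>UNIV. (?H + \<rho> * M i / (a * s)) / (a * (a * s) ^ ?n))"
  show thesis
  proof (rule that[of C])
    fix t and y :: "real^'n" assume t: "a < t" "t < b"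
    define z where "z = (1 / (t * s)) *\<^sub>R (y - (x + t *\<^sub>R v))"
    have t0: "0 < t" using a t by simp
    have \<rho>: "0 \<le> \<rho>" using t0 t s by (simp add: \<rho>_def)
    have "\<bar>\<Sum>i\<in>UNIV. partial_deriv i (radial_field x v s t i) y\<bar> \<le> C * indicator (cball x \<rho>) y"
    proof (cases "y \<in> cball x \<rho>")
      case True
      have "\<bar>partial_deriv i (radial_field x v s t i) y\<bar> \<le> (?H + \<rho> * M i / (a * s)) / (a * (a * s) ^ ?n)" for i
      proof -
        have "\<bar>(y - x) $ i\<bar> \<le> \<rho>"
          using component_le_norm_cart[of "y - x" i] True by (simp add: dist_norm norm_minus_commute)
        then have "\<bar>(y - x) $ i * partial_deriv i mollifier z\<bar> \<le> \<rho> * M i"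
          unfolding abs_mult by (intro mult_mono M \<rho>) auto
        then have "\<bar>(y - x) $ i * partial_deriv i mollifier z / (t * s)\<bar> \<le> \<rho> * M i / (a * s)"
          using a s t t0 \<rho> M0[of i] unfolding abs_divide by (intro frac_le) auto
        then have "\<bar>mollifier z + (y - x) $ i * partial_deriv i mollifier z / (t * s)\<bar> \<le> ?H + \<rho> * M i / (a * s)"
          using mollifier_nonneg[of z] mollifier_le[of z] by linarith
        then have "\<bar>(mollifier z + (y - x) $ i * partial_deriv i mollifier z / (t * s)) / (t * (t * s) ^ ?n)\<bar>
            \<le> (?H + \<rho> * M i / (a * s)) / (a * (a * s) ^ ?n)"
          using a s t t0 \<rho> M0[of i] mollifier_bound_pos[where 'n='n] unfolding abs_divide
          by (intro frac_le) (auto intro!: mult_mono power_mono)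
        then show ?thesis unfolding partial_deriv_radial_field[OF t0 s] z_def .
      qed
      then have "\<bar>\<Sum>i\<in>UNIV. partial_deriv i (radial_field x v s t i) y\<bar> \<le> C"
        unfolding C_def by (intro order_trans[OF sum_abs sum_mono]) auto
      then show ?thesis using True by simp
    next
      case False
      have "partial_deriv i (radial_field x v s t i) y = 0" for i
      proof (rule partial_deriv_eq_0[of "- cball x \<rho>"])
        show "radial_field x v s t i w = 0" if "w \<in> - cball x \<rho>" for w
        proof -
          have "t * (s + norm v) \<le> \<rho>"
            using t t0 s unfolding \<rho>_def by (intro mult_right_mono) (auto intro: add_nonneg_nonneg)
          moreover have "norm (w - x) \<le> norm (w - (x + t *\<^sub>R v)) + t * norm v"
            using norm_triangle_ineq[of "w - (x + t *\<^sub>R v)" "t *\<^sub>R v"] t0 by simp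
          ultimately have "w \<notin> cball (x + t *\<^sub>R v) (t * s)"
            using that by (simp add: dist_norm norm_minus_commute algebra_simps)
          then show ?thesis using moll_kernel_eq_0[of "t * s" w] t0 s by (simp add: radial_field_def)
        qed
      qed (use False in auto)
      then show ?thesis using False by simp
    qed
    then show "\<bar>\<Sum>i\<in>UNIV. partial_deriv i (radial_field x v s t i) y\<bar> \<le> C * indicator (cball x (b * (s + norm v))) y"
      by (simp add: \<rho>_def)
  qed
qed

text \<open>
  Differentiation under the integral, the continuity equation and the definition of the weak gradient, applied
  to the components of \<^const>\<open>radial_field\<close> as test functions. Thus no derivative of \<open>f\<close> itself is ever taken.
\<close>

lemma homothety_derivative:
  fixes f :: "real^'n::finite \<Rightarrow> real"
  assumes p: "1 \<le> p" and f: "weak_gradient p f G" and t: "0 < t" and s: "0 < s"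
  shows "((\<lambda>t. LINT y|lborel. f y * moll_kernel (x + t *\<^sub>R v) (t * s) y) has_real_derivative
           (\<Sum>i\<in>UNIV. LINT y|lborel. G i y * radial_field x v s t i y)) (at t)"
proof -
  have fm: "f \<in> borel_measurable borel" and fp: "integrable lborel (\<lambda>x. \<bar>f x\<bar> powr p)"
    and weak: "\<And>i \<phi>. test_function \<phi> \<Longrightarrow>
         (LINT x|lborel. f x * partial_deriv i \<phi> x) = - (LINT x|lborel. G i x * \<phi> x)"
    using f by (auto simp: weak_gradient_def)
  let ?div = "\<lambda>t y. \<Sum>i\<in>UNIV. partial_deriv i (radial_field x v s t i) y"
  obtain C where C: "\<And>t' y. t / 2 < t' \<Longrightarrow> t' < 2 * t \<Longrightarrow>
      \<bar>?div t' y\<bar> \<le> C * indicator (cball x (2 * t * (s + norm v))) y"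
    using radial_field_divergence_bound[of "t / 2" s "2 * t" x v] t s by auto
  note rf = test_function_radial_field[OF t s, of x v]
  have "((\<lambda>t. LINT y|lborel. f y * moll_kernel (x + t *\<^sub>R v) (t * s) y) has_real_derivative
      (LINT y|lborel. f y * - ?div t y)) (at t)"
  proof (rule has_real_derivative_integral[where a = "t / 2" and b = "2 * t"
        and B = "\<lambda>y. \<bar>f y\<bar> * (C * indicator (cball x (2 * t * (s + norm v))) y)"])
    show "integrable lborel (\<lambda>y. f y * moll_kernel (x + t' *\<^sub>R v) (t' * s) y)" if "t / 2 < t'" for t'
      using that t s by (intro integrable_Lp_moll_kernel[OF p fm fp]) auto
    show "((\<lambda>t. f y * moll_kernel (x + t *\<^sub>R v) (t * s) y) has_real_derivative f y * - ?div t' y) (at t')"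
      if "t / 2 < t'" for t' y
      using that t by (intro DERIV_cmult moll_kernel_homothety_derivative s) auto
    show "\<bar>f y * - ?div t' y\<bar> \<le> \<bar>f y\<bar> * (C * indicator (cball x (2 * t * (s + norm v))) y)"
      if "t / 2 < t'" "t' < 2 * t" for t' y
      using C[OF that, of y] unfolding abs_mult abs_minus_cancel by (intro mult_left_mono) auto
    show "integrable lborel (\<lambda>y. \<bar>f y\<bar> * (C * indicator (cball x (2 * t * (s + norm v))) y))"
      by (rule integrable_locally_Lp[OF p, where M = "\<bar>C\<bar>" and c = x and R = "2 * t * (s + norm v)"])
        (use fm fp in \<open>auto simp: indicator_def\<close>)
    have "?div t \<in> borel_measurable borel"
      by (intro borel_measurable_sum continuous_UNIV_borel test_function_continuous(2)[OF rf])
    then show "(\<lambda>y. f y * - ?div t y) \<in> borel_measurable lborel" using fm by simp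
  qed (use t in auto)
  also have "(LINT y|lborel. f y * - ?div t y) =
      - (LINT y|lborel. (\<Sum>i\<in>UNIV. f y * partial_deriv i (radial_field x v s t i) y))"
    by (simp add: sum_distrib_left)
  also have "\<dots> = - (\<Sum>i\<in>UNIV. LINT y|lborel. f y * partial_deriv i (radial_field x v s t i) y)"
    by (subst Bochner_Integration.integral_sum) (auto intro!: integrable_Lp_test[OF p fm fp rf])
  also have "\<dots> = (\<Sum>i\<in>UNIV. LINT y|lborel. G i y * radial_field x v s t i y)"
    by (simp add: weak[OF rf] sum_negf)
  finally show ?thesis .
qed

section \<open>Morrey's inequality\<close>

text \<open>
  Optimising over \<open>m\<close> in Young's inequality gives Hoelder's inequality, up to the factor \<open>2\<close>.
\<close>

lemma le_of_young_family:
  fixes p Q X :: real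
  assumes p: "1 < p" and Q: "0 \<le> Q" and X: "\<And>m. 0 < m \<Longrightarrow> X \<le> m + m powr (1 - p) * Q"
  shows "X \<le> 2 * Q powr (1 / p)"
proof (cases "Q = 0")
  case True
  have "X \<le> 0" by (rule field_le_epsilon) (use X True in auto)
  then show ?thesis using True by simp
next
  case False
  define m where "m = Q powr (1 / p)"
  have m: "0 < m" "m powr p = Q" using False Q p by (auto simp: m_def powr_powr)
  have "m powr (1 - p) * Q = m"
    using m powr_add[of m "1 - p" p] by simp
  then show ?thesis using X[OF m(1)] by (simp add: m_def)
qed

lemma abs_le_young:
  fixes a m p :: real
  assumes "1 \<le> p" "0 < m"
  shows "\<bar>a\<bar> \<le> m + m powr (1 - p) * \<bar>a\<bar> powr p"
proof -
  have "\<bar>a / m\<bar> \<le> 1 + \<bar>a / m\<bar> powr p" by (rule abs_le_1_plus_powr[OF assms(1)])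
  then have "\<bar>a\<bar> / m * m \<le> (1 + \<bar>a\<bar> powr p / m powr p) * m"
    using assms(2) by (intro mult_right_mono) (auto simp: powr_divide)
  then show ?thesis using assms(2) by (simp add: powr_diff algebra_simps)
qed

text \<open>
  The \<open>p\<close>-th power of the \<open>L\<^sup>p\<close> norm over \<open>B\<close> of the weak gradient, measured in the \<open>l\<^sup>p\<close> norm.
  As a function of \<open>B\<close> it is a measure, and this additivity is what controls sums over coverings.
\<close>

definition energy :: "real \<Rightarrow> ('n::finite \<Rightarrow> real^'n \<Rightarrow> real) \<Rightarrow> (real^'n) set \<Rightarrow> real" where
  "energy p G B = (LINT y|lborel. indicator B y * (\<Sum>i\<in>UNIV. \<bar>G i y\<bar> powr p))"

lemma integrable_energy_density:
  assumes "weak_gradient p f G" "B \<in> sets borel"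
  shows "integrable lborel (\<lambda>y. indicator B y * (\<Sum>i\<in>UNIV. \<bar>G i y\<bar> powr p))"
proof -
  have "integrable lborel (\<lambda>y. \<Sum>i\<in>UNIV. \<bar>G i y\<bar> powr p)"
    using assms(1) by (auto simp: weak_gradient_def)
  from integrable_mult_indicator[OF _ this, of B] show ?thesis using assms(2) by simp
qed

lemma energy_nonneg: "0 \<le> energy p G B"
  unfolding energy_def by (intro integral_nonneg_AE) (auto intro!: sum_nonneg mult_nonneg_nonneg)

lemma energy_mono:
  assumes "weak_gradient p f G" "A \<in> sets borel" "B \<in> sets borel" "A \<subseteq> B"
  shows "energy p G A \<le> energy p G B"
  unfolding energy_def using assms
  by (intro integral_mono integrable_energy_density)
     (auto simp: indicator_def intro!: sum_nonneg)

text \<open>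
  Hoelder's inequality for the probability density \<^const>\<open>moll_kernel\<close>, whose supremum is of order
  \<open>r powr (- n)\<close>.
\<close>

lemma moll_kernel_average_le:
  fixes G :: "'n::finite \<Rightarrow> real^'n \<Rightarrow> real"
  assumes p: "1 < p" and f: "weak_gradient p f G" and r: "0 < r" "cball a r \<subseteq> B" "B \<in> sets borel"
  shows "(LINT y|lborel. \<bar>G i y\<bar> * moll_kernel a r y) \<le>
     2 * (mollifier_bound TYPE('n) / r ^ CARD('n) * energy p G B) powr (1 / p)"
proof (rule le_of_young_family[OF p])
  let ?H = "mollifier_bound TYPE('n)"
  have G: "G i \<in> borel_measurable borel" "integrable lborel (\<lambda>x. \<bar>G i x\<bar> powr p)"
    using f by (auto simp: weak_gradient_def)
  show "0 \<le> ?H / r ^ CARD('n) * energy p G B"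
    using energy_nonneg[of p G B] mollifier_bound_pos[where 'n='n] r by simp
  fix m :: real assume m: "0 < m"
  have "(LINT y|lborel. \<bar>G i y\<bar> * moll_kernel a r y) \<le>
     (LINT y|lborel. m * moll_kernel a r y + m powr (1 - p) * (?H / r ^ CARD('n) * (indicator B y * (\<Sum>i\<in>UNIV. \<bar>G i y\<bar> powr p))))"
  proof (rule integral_mono)
    show "integrable lborel (\<lambda>y. \<bar>G i y\<bar> * moll_kernel a r y)"
      by (rule integrable_Lp_moll_kernel) (use p G r in auto)
    show "integrable lborel (\<lambda>y. m * moll_kernel a r y + m powr (1 - p) *
        (?H / r ^ CARD('n) * (indicator B y * (\<Sum>i\<in>UNIV. \<bar>G i y\<bar> powr p))))"
      by (intro Bochner_Integration.integrable_add integrable_mult_right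
          integrable_energy_density[OF f r(3)] integrable_moll_kernel[OF r(1)])
    fix y
    show "\<bar>G i y\<bar> * moll_kernel a r y \<le> m * moll_kernel a r y + m powr (1 - p) *
        (?H / r ^ CARD('n) * (indicator B y * (\<Sum>i\<in>UNIV. \<bar>G i y\<bar> powr p)))"
    proof (cases "y \<in> cball a r")
      case True
      have "\<bar>G i y\<bar> * moll_kernel a r y \<le> (m + m powr (1 - p) * \<bar>G i y\<bar> powr p) * moll_kernel a r y"
        using p m r by (intro mult_right_mono abs_le_young moll_kernel_nonneg) auto
      moreover have "moll_kernel a r y * \<bar>G i y\<bar> powr p \<le> ?H / r ^ CARD('n) * (\<Sum>i\<in>UNIV. \<bar>G i y\<bar> powr p)"
        using r moll_kernel_le[OF r(1), of a y] mollifier_bound_pos[where 'n='n]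
        by (intro mult_mono member_le_sum) auto
      then have "m powr (1 - p) * (moll_kernel a r y * \<bar>G i y\<bar> powr p) \<le>
          m powr (1 - p) * (?H / r ^ CARD('n) * (\<Sum>i\<in>UNIV. \<bar>G i y\<bar> powr p))"
        by (rule mult_left_mono) simp
      ultimately show ?thesis using True r(2) by (auto simp: algebra_simps)
    next
      case False
      then show ?thesis using moll_kernel_eq_0[OF r(1) False] r(1) mollifier_bound_pos[where 'n='n]
        by (auto intro!: sum_nonneg mult_nonneg_nonneg divide_nonneg_pos simp: less_imp_le)
    qed
  qed
  also have "\<dots> = m + m powr (1 - p) * (?H / r ^ CARD('n) * energy p G B)"
    using integrable_energy_density[OF f r(3)] integrable_moll_kernel[OF r(1)]
    by (subst Bochner_Integration.integral_add) (auto simp: integral_moll_kernel(1)[OF r(1)] energy_def)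
  finally show "(LINT y|lborel. \<bar>G i y\<bar> * moll_kernel a r y) \<le> m + m powr (1 - p) * (?H / r ^ CARD('n) * energy p G B)" .
qed

text \<open>
  The denominator is the exponent \<open>\<alpha> = 1 - n / p\<close>. It comes from integrating \<open>t powr (\<alpha> - 1)\<close> and is positive
  exactly when \<open>p > n\<close>.
\<close>

definition morrey_const :: "real \<Rightarrow> 'n::finite itself \<Rightarrow> real" where
  "morrey_const p _ = 4 * real CARD('n) * mollifier_bound TYPE('n) powr (1 / p) / (1 - real CARD('n) / p)"

lemma morrey_const_pos: "real CARD('n::finite) < p \<Longrightarrow> 0 < morrey_const p TYPE('n)"
  using mollifier_bound_pos[where 'n='n]
  by (auto simp: morrey_const_def intro!: divide_pos_pos)

lemma card_less_imp_one_less: "real CARD('n::finite) < p \<Longrightarrow> 1 < p"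
proof -
  assume "real CARD('n) < p"
  moreover have "1 \<le> real CARD('n)" by (simp add: Suc_leI)
  ultimately show ?thesis by linarith
qed

text \<open>
  The derivative along the homothety is at most a constant times \<open>s powr \<alpha> * t powr (\<alpha> - 1)\<close>, since the
  velocity is at most \<open>2 * s\<close> on the support and the average of the gradient is controlled by
  \<open>moll_kernel_average_le\<close>. As \<open>\<alpha> > 0\<close> this is integrable up to \<open>t = 0\<close>, which is where \<open>p > n\<close> enters.
\<close>

lemma homothety_difference_le:
  fixes f :: "real^'n::finite \<Rightarrow> real" and p :: real
  defines "\<alpha> \<equiv> 1 - real CARD('n) / p"
  assumes p: "real CARD('n) < p" and f: "weak_gradient p f G"
    and s: "0 < s" and v: "norm v \<le> s" and ab: "0 < a" "a < b"
    and B: "B \<in> sets borel" "\<And>t. 0 < t \<Longrightarrow> t < b \<Longrightarrow> cball (x + t *\<^sub>R v) (t * s) \<subseteq> B"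
  shows "\<bar>(LINT y|lborel. f y * moll_kernel (x + b *\<^sub>R v) (b * s) y) - (LINT y|lborel. f y * moll_kernel (x + a *\<^sub>R v) (a * s) y)\<bar>
    \<le> morrey_const p TYPE('n) * s powr \<alpha> * energy p G B powr (1 / p) * (b powr \<alpha> - a powr \<alpha>)"
proof -
  let ?n = "CARD('n)" and ?H = "mollifier_bound TYPE('n)"
  let ?F = "\<lambda>t. LINT y|lborel. f y * moll_kernel (x + t *\<^sub>R v) (t * s) y"
  let ?F' = "\<lambda>t. \<Sum>i\<in>UNIV. LINT y|lborel. G i y * radial_field x v s t i y"
  have p1: "1 < p" using p by (rule card_less_imp_one_less)
  have \<alpha>: "0 < \<alpha>" using p p1 by (simp add: \<alpha>_def)
  define K where "K = morrey_const p TYPE('n) * s powr \<alpha> * energy p G B powr (1 / p)"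
  have F': "(?F has_real_derivative ?F' t) (at t)" if "0 < t" for t
    using homothety_derivative[OF _ f that s] p1 by simp
  have bound: "\<bar>?F' t\<bar> \<le> K * (\<alpha> * t powr (\<alpha> - 1))" if t: "0 < t" "t < b" for t
  proof -
    define E where "E = (?H / (t * s) ^ ?n * energy p G B) powr (1 / p)"
    have ts: "0 < t * s" using t s by simp
    have "\<bar>LINT y|lborel. G i y * radial_field x v s t i y\<bar> \<le> 2 * s * (2 * E)" for i
    proof -
      have Gi: "G i \<in> borel_measurable borel" "integrable lborel (\<lambda>x. \<bar>G i x\<bar> powr p)"
        using f by (auto simp: weak_gradient_def)
      have "\<bar>LINT y|lborel. G i y * radial_field x v s t i y\<bar> \<le> (LINT y|lborel. \<bar>G i y * radial_field x v s t i y\<bar>)"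
        by (rule integral_abs_bound)
      also have "\<dots> \<le> (LINT y|lborel. 2 * s * (\<bar>G i y\<bar> * moll_kernel (x + t *\<^sub>R v) (t * s) y))"
      proof (rule integral_mono)
        show "integrable lborel (\<lambda>y. \<bar>G i y * radial_field x v s t i y\<bar>)"
          using integrable_Lp_test(1)[OF _ Gi test_function_radial_field[OF t(1) s]] p1 by simp
        show "integrable lborel (\<lambda>y. 2 * s * (\<bar>G i y\<bar> * moll_kernel (x + t *\<^sub>R v) (t * s) y))"
          by (intro integrable_mult_right integrable_Lp_moll_kernel) (use p1 Gi ts in auto)
        fix y
        show "\<bar>G i y * radial_field x v s t i y\<bar> \<le> 2 * s * (\<bar>G i y\<bar> * moll_kernel (x + t *\<^sub>R v) (t * s) y)"
        proof (cases "y \<in> cball (x + t *\<^sub>R v) (t * s)")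
          case True
          have "norm (y - x) \<le> norm (y - (x + t *\<^sub>R v)) + t * norm v"
            using norm_triangle_ineq[of "y - (x + t *\<^sub>R v)" "t *\<^sub>R v"] t by simp
          also have "\<dots> \<le> t * s + t * s"
            using True v t by (intro add_mono mult_left_mono) (auto simp: dist_norm norm_minus_commute)
          finally have "\<bar>(y - x) $ i\<bar> \<le> 2 * s * t"
            using component_le_norm_cart[of "y - x" i] by simp
          then have "\<bar>(y - x) $ i / t\<bar> \<le> 2 * s"
            using t unfolding abs_divide by (simp add: field_simps)
          then have "\<bar>(y - x) $ i / t\<bar> * (\<bar>G i y\<bar> * moll_kernel (x + t *\<^sub>R v) (t * s) y) \<le>
              2 * s * (\<bar>G i y\<bar> * moll_kernel (x + t *\<^sub>R v) (t * s) y)"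
            by (intro mult_right_mono mult_nonneg_nonneg moll_kernel_nonneg[OF ts]) auto
          then show ?thesis
            using moll_kernel_nonneg[OF ts, of "x + t *\<^sub>R v" y] by (simp add: radial_field_def abs_mult mult_ac)
        next
          case False
          then have "moll_kernel (x + t *\<^sub>R v) (t * s) y = 0" by (rule moll_kernel_eq_0[OF ts])
          then show ?thesis by (simp add: radial_field_def)
        qed
      qed
      also have "\<dots> = 2 * s * (LINT y|lborel. \<bar>G i y\<bar> * moll_kernel (x + t *\<^sub>R v) (t * s) y)" by simp
      also have "\<dots> \<le> 2 * s * (2 * E)"
        unfolding E_def using s by (intro mult_left_mono moll_kernel_average_le[OF p1 f ts B(2)[OF t] B(1)]) auto
      finally show ?thesis .
    qed
    then have "\<bar>?F' t\<bar> \<le> (\<Sum>i\<in>(UNIV :: 'n set). 2 * s * (2 * E))"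
      by (intro order_trans[OF sum_abs sum_mono]) auto
    also have "\<dots> = 4 * real ?n * s * E" by simp
    also have "E = ?H powr (1 / p) * energy p G B powr (1 / p) * (s powr (\<alpha> - 1) * t powr (\<alpha> - 1))"
    proof -
      have "((t * s) ^ ?n) powr (1 / p) = (t * s) powr (real ?n / p)"
        using ts by (simp add: powr_realpow[symmetric] powr_powr)
      then show ?thesis
        unfolding E_def \<alpha>_def using mollifier_bound_pos[where 'n='n] energy_nonneg[of p G B] t s
        by (simp add: powr_mult powr_divide powr_minus_divide)
    qed
    also have "4 * real ?n * s * (?H powr (1 / p) * energy p G B powr (1 / p) * (s powr (\<alpha> - 1) * t powr (\<alpha> - 1)))
       = (4 * real ?n * ?H powr (1 / p)) * (s * s powr (\<alpha> - 1)) * energy p G B powr (1 / p) * t powr (\<alpha> - 1)"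
      by (simp add: mult_ac)
    also have "4 * real ?n * ?H powr (1 / p) = morrey_const p TYPE('n) * \<alpha>"
      using p p1 by (simp add: morrey_const_def \<alpha>_def)
    also have "s * s powr (\<alpha> - 1) = s powr \<alpha>" using s by (simp add: powr_mult_base)
    finally show ?thesis by (simp add: K_def mult_ac)
  qed
  have "norm (?F b - ?F a) \<le> K * b powr \<alpha> - K * a powr \<alpha>"
  proof (rule differentiable_bound_general[where f' = ?F' and \<phi>' = "\<lambda>t. K * (\<alpha> * t powr (\<alpha> - 1))"])
    show "continuous_on {a..b} ?F"
      using F' ab by (intro DERIV_continuous_on[where D = ?F']) (auto intro: has_field_derivative_at_within)
    show "(?F has_vector_derivative ?F' t) (at t)" if "a < t" for t
      using F'[of t] that ab by (simp add: has_real_derivative_iff_has_vector_derivative)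
    have "((\<lambda>t. K * t powr \<alpha>) has_real_derivative K * (\<alpha> * t powr (\<alpha> - 1))) (at t)" if "a < t" for t
      using that ab by (intro DERIV_cmult has_real_derivative_powr) auto
    then show "((\<lambda>t. K * t powr \<alpha>) has_vector_derivative K * (\<alpha> * t powr (\<alpha> - 1))) (at t)" if "a < t" for t
      using that by (simp add: has_real_derivative_iff_has_vector_derivative)
    show "continuous_on {a..b} (\<lambda>t. K * t powr \<alpha>)"
      using ab by (intro continuous_intros) auto
  qed (use ab bound in auto)
  then show ?thesis by (simp add: K_def algebra_simps)
qed

lemma moll_kernel_average_close:
  fixes g :: "real^'n::finite \<Rightarrow> real"
  assumes g: "continuous_on UNIV g" and r: "0 < r"
    and close: "\<And>y. y \<in> cball a r \<Longrightarrow> \<bar>g y - c\<bar> \<le> e"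
  shows "\<bar>(LINT y|lborel. g y * moll_kernel a r y) - c\<bar> \<le> e"
proof -
  have cont: "continuous_on UNIV (moll_kernel a r)"
    by (intro continuous_on_moll_kernel continuous_intros r)
  have int: "integrable lborel (\<lambda>y. g y * moll_kernel a r y)"
    by (rule integrable_continuous_compact_support[of _ a r])
       (auto intro!: continuous_intros g cont simp: moll_kernel_eq_0[OF r])
  note ik = integrable_moll_kernel[OF r, of a]
  have "(LINT y|lborel. g y * moll_kernel a r y) - c = (LINT y|lborel. g y * moll_kernel a r y - c * moll_kernel a r y)"
    using int ik by (subst Bochner_Integration.integral_diff) (auto simp: integral_moll_kernel(1)[OF r])
  also have "\<bar>\<dots>\<bar> \<le> (LINT y|lborel. \<bar>g y * moll_kernel a r y - c * moll_kernel a r y\<bar>)"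
    by (rule integral_abs_bound)
  also have "\<dots> \<le> (LINT y|lborel. e * moll_kernel a r y)"
  proof (rule integral_mono)
    show "integrable lborel (\<lambda>y. \<bar>g y * moll_kernel a r y - c * moll_kernel a r y\<bar>)"
      by (intro integrable_abs Bochner_Integration.integrable_diff int integrable_mult_right ik)
    show "integrable lborel (\<lambda>y. e * moll_kernel a r y)" by (intro integrable_mult_right ik)
    fix y
    show "\<bar>g y * moll_kernel a r y - c * moll_kernel a r y\<bar> \<le> e * moll_kernel a r y"
    proof (cases "y \<in> cball a r")
      case True
      have "\<bar>g y - c\<bar> * moll_kernel a r y \<le> e * moll_kernel a r y"
        by (rule mult_right_mono[OF close[OF True] moll_kernel_nonneg[OF r]])
      then show ?thesis
        using moll_kernel_nonneg[OF r, of a y] by (simp add: left_diff_distrib[symmetric] abs_mult)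
    next
      case False
      then have "moll_kernel a r y = 0" by (rule moll_kernel_eq_0[OF r])
      then show ?thesis by simp
    qed
  qed
  also have "\<dots> = e" by (simp add: integral_moll_kernel(1)[OF r])
  finally show ?thesis .
qed

text \<open>
  The limit \<open>t \<rightarrow> 0\<close> of \<open>homothety_difference_le\<close> between \<open>t\<close> and \<open>1\<close>: the averages near \<open>x\<close> converge to the value
  at \<open>x\<close> by continuity.
\<close>

lemma moll_kernel_average_minus_value_le:
  fixes g :: "real^'n::finite \<Rightarrow> real" and p :: real
  defines "\<alpha> \<equiv> 1 - real CARD('n) / p"
  assumes p: "real CARD('n) < p" and g: "continuous_on UNIV g" "weak_gradient p g G"
    and s: "0 < s" and v: "norm v \<le> s"
  shows "\<bar>(LINT y|lborel. g y * moll_kernel (x + v) s y) - g x\<bar>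
    \<le> morrey_const p TYPE('n) * s powr \<alpha> * energy p G (cball (x + v) s) powr (1 / p)"
proof (rule field_le_epsilon)
  fix e :: real assume "0 < e"
  define K where "K = morrey_const p TYPE('n) * s powr \<alpha> * energy p G (cball (x + v) s) powr (1 / p)"
  have K0: "0 \<le> K" using morrey_const_pos[OF p] by (simp add: K_def)
  have "isCont g x" using g(1) by (simp add: continuous_on_eq_continuous_at)
  then obtain d where d: "0 < d" "\<And>y. dist y x < d \<Longrightarrow> \<bar>g y - g x\<bar> < e"
    using \<open>0 < e\<close> by (auto simp: continuous_at_eps_delta dist_real_def)
  \<comment> \<open>Points of the ball of radius \<open>a * s\<close> around \<open>x + a v\<close> are within \<open>2
      * a * s < d\<close> of \<open>x\<close>.\<close>
  define a where "a = min (1 / 2) (d / (4 * s))"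
  have a: "0 < a" "a < 1" "a * s < d / 2"
  proof -
    have "a * s \<le> d / (4 * s) * s" using s by (intro mult_right_mono) (auto simp: a_def)
    also have "\<dots> < d / 2" using s d by (simp add: field_simps)
    finally show "a * s < d / 2" .
  qed (use s d in \<open>auto simp: a_def\<close>)
  have "\<bar>(LINT y|lborel. g y * moll_kernel (x + a *\<^sub>R v) (a * s) y) - g x\<bar> \<le> e"
  proof (rule moll_kernel_average_close[OF g(1)])
    fix y assume y: "y \<in> cball (x + a *\<^sub>R v) (a * s)"
    have "norm (y - x) \<le> norm (y - (x + a *\<^sub>R v)) + a * norm v"
      using norm_triangle_ineq[of "y - (x + a *\<^sub>R v)" "a *\<^sub>R v"] a by simp
    also have "\<dots> \<le> a * s + a * s"
      using y v a by (intro add_mono mult_left_mono) (auto simp: dist_norm norm_minus_commute)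
    finally show "\<bar>g y - g x\<bar> \<le> e" using d(2)[of y] a by (simp add: dist_norm)
  qed (use a s in simp)
  moreover have "\<bar>(LINT y|lborel. g y * moll_kernel (x + 1 *\<^sub>R v) (1 * s) y) - (LINT y|lborel. g y * moll_kernel (x + a *\<^sub>R v) (a * s) y)\<bar>
    \<le> K * (1 powr \<alpha> - a powr \<alpha>)"
    unfolding K_def \<alpha>_def
  proof (rule homothety_difference_le[OF p g(2) s v a(1,2)])
    show "cball (x + t *\<^sub>R v) (t * s) \<subseteq> cball (x + v) s" if t: "0 < t" "t < 1" for t
    proof
      fix y assume y: "y \<in> cball (x + t *\<^sub>R v) (t * s)"
      have "norm (y - (x + v)) \<le> norm (y - (x + t *\<^sub>R v)) + norm ((1 - t) *\<^sub>R v)"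
        using norm_triangle_ineq4[of "y - (x + t *\<^sub>R v)" "(1 - t) *\<^sub>R v"] by (simp add: algebra_simps)
      also have "\<dots> \<le> t * s + (1 - t) * s"
        using y v t by (intro add_mono) (auto simp: dist_norm norm_minus_commute intro: mult_left_mono)
      finally show "y \<in> cball (x + v) s" by (simp add: dist_norm norm_minus_commute algebra_simps)
    qed
  qed simp
  moreover have "K * (1 powr \<alpha> - a powr \<alpha>) \<le> K" using K0 by (intro mult_left_le) auto
  ultimately have "\<bar>(LINT y|lborel. g y * moll_kernel (x + v) s y) - g x\<bar> \<le> K + e" by simp
  then show "\<bar>(LINT y|lborel. g y * moll_kernel (x + v) s y) - g x\<bar>
    \<le> morrey_const p TYPE('n) * s powr \<alpha> * energy p G (cball (x + v) s) powr (1 / p) + e"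
    by (simp add: K_def)
qed

text \<open>
  Both values are compared with one and the same average, over the ball around \<open>x\<close> that reaches \<open>y\<close>. That is
  why the homotheties were allowed an offset \<open>v\<close> as large as the radius.
\<close>

lemma morrey_inequality:
  fixes g :: "real^'n::finite \<Rightarrow> real" and p :: real
  assumes p: "real CARD('n) < p" and g: "continuous_on UNIV g" "weak_gradient p g G"
  shows "\<bar>g x - g y\<bar> \<le> 2 * morrey_const p TYPE('n) * dist x y powr (1 - real CARD('n) / p) *
    energy p G (cball x (dist x y)) powr (1 / p)"
proof (cases "x = y")
  case False
  then have s: "0 < dist x y" by simp
  have "\<bar>(LINT z|lborel. g z * moll_kernel (x + 0) (dist x y) z) - g x\<bar>
    \<le> morrey_const p TYPE('n) * dist x y powr (1 - real CARD('n) / p) * energy p G (cball (x + 0) (dist x y)) powr (1 / p)"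
    by (rule moll_kernel_average_minus_value_le[OF p g s]) simp
  moreover have "\<bar>(LINT z|lborel. g z * moll_kernel (y + (x - y)) (dist x y) z) - g y\<bar>
    \<le> morrey_const p TYPE('n) * dist x y powr (1 - real CARD('n) / p) * energy p G (cball (y + (x - y)) (dist x y)) powr (1 / p)"
    by (rule moll_kernel_average_minus_value_le[OF p g s]) (simp add: dist_norm)
  ultimately show ?thesis by simp
qed simp

section \<open>Coverings by balls of equal radius\<close>

text \<open>
  Comparison of volumes: the disjoint balls of radius \<open>\<rho>\<close> all lie in \<open>ball y (R + \<rho>)\<close>.
\<close>

lemma card_disjoint_balls_le:
  fixes x :: "nat \<Rightarrow> 'a::euclidean_space"
  assumes F: "finite F" and \<rho>: "0 < \<rho>" "0 \<le> R" and near: "\<And>i. i \<in> F \<Longrightarrow> dist (x i) y \<le> R"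
    and disj: "\<And>i j. i \<in> F \<Longrightarrow> j \<in> F \<Longrightarrow> i \<noteq> j \<Longrightarrow> ball (x i) \<rho> \<inter> ball (x j) \<rho> = {}"
  shows "real (card F) \<le> ((R + \<rho>) / \<rho>) ^ DIM('a)"
proof -
  let ?V = "unit_ball_vol (real DIM('a))"
  have V: "0 < ?V" by (rule unit_ball_vol_pos) simp
  have "real (card F) * (?V * \<rho> ^ DIM('a)) = (\<Sum>i\<in>F. measure lborel (ball (x i) \<rho>))"
    using \<rho> by (simp add: content_ball)
  also have "\<dots> = measure lborel (\<Union>i\<in>F. ball (x i) \<rho>)"
    using F disj \<rho>
    by (intro measure_finite_Union[symmetric]) (auto simp: disjoint_family_on_def emeasure_ball)
  also have "\<dots> \<le> measure lborel (ball y (R + \<rho>))"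
  proof (rule measure_mono_fmeasurable)
    show "(\<Union>i\<in>F. ball (x i) \<rho>) \<subseteq> ball y (R + \<rho>)"
    proof safe
      fix i z assume "i \<in> F" "z \<in> ball (x i) \<rho>"
      then show "z \<in> ball y (R + \<rho>)"
        using near[of i] dist_triangle[of y z "x i"] by (simp add: dist_commute)
    qed
  qed (use F \<rho> in \<open>auto intro!: fmeasurableI simp: emeasure_ball\<close>)
  also have "\<dots> = ?V * (R + \<rho>) ^ DIM('a)" using \<rho> by (simp add: content_ball)
  finally have "real (card F) * \<rho> ^ DIM('a) \<le> (R + \<rho>) ^ DIM('a)"
    using V by (simp add: mult.left_commute)
  then show ?thesis using \<rho> by (simp add: power_divide pos_le_divide_eq)
qed

text \<open>
  A point lies in boundedly many of the enlarged balls, so the energies add up to at most a multiple of the total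
  energy. The bound depends only on \<open>R / \<rho>\<close>; for this the common radius is essential.
\<close>

lemma sum_energy_balls_le:
  fixes x :: "nat \<Rightarrow> real^'n::finite"
  assumes G: "weak_gradient p f G" and F: "finite F" and \<rho>: "0 < \<rho>" "0 \<le> R"
    and disj: "\<And>i j. i \<in> F \<Longrightarrow> j \<in> F \<Longrightarrow> i \<noteq> j \<Longrightarrow> ball (x i) \<rho> \<inter> ball (x j) \<rho> = {}"
  shows "(\<Sum>i\<in>F. energy p G (ball (x i) R)) \<le> ((R + \<rho>) / \<rho>) ^ CARD('n) * energy p G UNIV"
proof -
  let ?h = "\<lambda>y. \<Sum>i\<in>UNIV. \<bar>G i y\<bar> powr p"
  have h0: "0 \<le> ?h y" for y by (intro sum_nonneg) simp
  have "(\<Sum>i\<in>F. energy p G (ball (x i) R)) = (LINT y|lborel. (\<Sum>i\<in>F. indicator (ball (x i) R) y * ?h y))"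
    unfolding energy_def
    by (rule Bochner_Integration.integral_sum[symmetric]) (intro integrable_energy_density[OF G], simp)
  also have "\<dots> \<le> (LINT y|lborel. ((R + \<rho>) / \<rho>) ^ CARD('n) * (indicator UNIV y * ?h y))"
  proof (rule integral_mono)
    show "integrable lborel (\<lambda>y. \<Sum>i\<in>F. indicator (ball (x i) R) y * ?h y)"
      by (intro Bochner_Integration.integrable_sum integrable_energy_density[OF G]) simp
    show "integrable lborel (\<lambda>y. ((R + \<rho>) / \<rho>) ^ CARD('n) * (indicator UNIV y * ?h y))"
      by (intro integrable_mult_right integrable_energy_density[OF G]) simp
    fix y
    have "(\<Sum>i\<in>F. indicator (ball (x i) R) y :: real) = real (card {i \<in> F. y \<in> ball (x i) R})"
      using F by (simp add: indicator_def sum.If_cases Int_def)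
    also have "\<dots> \<le> ((R + \<rho>) / \<rho>) ^ DIM(real^'n)"
      by (rule card_disjoint_balls_le[where y = y and x = x]) (use F \<rho> disj in auto)
    finally have "(\<Sum>i\<in>F. indicator (ball (x i) R) y) * ?h y \<le> ((R + \<rho>) / \<rho>) ^ CARD('n) * ?h y"
      by (intro mult_right_mono h0) simp
    then show "(\<Sum>i\<in>F. indicator (ball (x i) R) y * ?h y) \<le> ((R + \<rho>) / \<rho>) ^ CARD('n) * (indicator UNIV y * ?h y)"
      by (simp add: sum_distrib_right)
  qed
  also have "\<dots> = ((R + \<rho>) / \<rho>) ^ CARD('n) * energy p G UNIV"
    unfolding energy_def by (rule integral_mult_right_zero)
  finally show ?thesis .
qed

lemma ennreal_rpow_le:
  assumes "a \<le> ennreal b" "0 \<le> b" "0 \<le> p"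
  shows "ennreal_rpow a p \<le> ennreal (b powr p)"
proof -
  have "a \<noteq> \<infinity>" using assms(1) by (auto simp: top_unique)
  moreover have "enn2real a \<le> b" using assms by (intro enn2real_leI) auto
  ultimately show ?thesis
    using assms by (auto simp: ennreal_rpow_def intro!: ennreal_leI powr_mono2)
qed

text \<open>
  For \<open>x\<close> and \<open>y\<close> in a ball of radius \<open>r\<close>, the ball around \<open>x\<close> that reaches \<open>y\<close> lies in the ball of
  radius \<open>3 * r\<close> with the same centre.
\<close>

lemma holder_seminorm_ball_le:
  fixes g :: "real^'n::finite \<Rightarrow> real" and p :: real
  assumes p: "real CARD('n) < p" and g: "continuous_on UNIV g" "weak_gradient p g G"
  shows "holder_seminorm (1 - real CARD('n) / p) (ball c r) g \<le>
    ennreal (2 * morrey_const p TYPE('n) * energy p G (ball c (3 * r)) powr (1 / p))"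
  unfolding holder_seminorm_def
proof (rule SUP_least, clarify, rule ennreal_leI)
  fix x y assume xy: "x \<in> ball c r" "y \<in> ball c r" "x \<noteq> y"
  let ?C = "2 * morrey_const p TYPE('n)" and ?\<alpha> = "1 - real CARD('n) / p"
  have C: "0 \<le> ?C" using morrey_const_pos[OF p] by simp
  have p1: "1 < p" using p by (rule card_less_imp_one_less)
  have "cball x (dist x y) \<subseteq> ball c (3 * r)"
  proof
    fix z assume "z \<in> cball x (dist x y)"
    then show "z \<in> ball c (3 * r)"
      using xy dist_triangle[of c z x] dist_triangle[of x y c] by (simp add: dist_commute)
  qed
  then have "energy p G (cball x (dist x y)) \<le> energy p G (ball c (3 * r))"
    by (intro energy_mono[OF g(2)]) auto
  then have "energy p G (cball x (dist x y)) powr (1 / p) \<le> energy p G (ball c (3 * r)) powr (1 / p)"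
    using p1 by (intro powr_mono2 energy_nonneg) auto
  then have "?C * dist x y powr ?\<alpha> * energy p G (cball x (dist x y)) powr (1 / p) \<le>
      ?C * dist x y powr ?\<alpha> * energy p G (ball c (3 * r)) powr (1 / p)"
    using C by (intro mult_left_mono) auto
  from order_trans[OF morrey_inequality[OF p g] this]
  have "\<bar>g x - g y\<bar> \<le> ?C * energy p G (ball c (3 * r)) powr (1 / p) * dist x y powr ?\<alpha>"
    by (simp add: mult_ac)
  then show "\<bar>g x - g y\<bar> / dist x y powr ?\<alpha> \<le> ?C * energy p G (ball c (3 * r)) powr (1 / p)"
    using xy by (simp add: pos_divide_le_eq)
qed

text \<open>
  The \<open>p\<close>-th power of the Hoelder seminorm on a ball is bounded by the energy of the threefold ball, and these
  balls overlap boundedly often.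
\<close>

lemma weak_gradient_imp_CH:
  fixes g :: "real^'n::finite \<Rightarrow> real" and p :: real
  assumes p: "real CARD('n) < p" and g: "continuous_on UNIV g" "weak_gradient p g G"
  shows "g \<in> CH p (1 - real CARD('n) / p)"
  unfolding CH_def
proof (intro CollectI allI impI, elim conjE)
  fix E :: "(real^'n) set" and \<epsilon> :: real
  assume \<epsilon>: "0 < \<epsilon>" "\<epsilon> < 1"
  let ?C = "2 * morrey_const p TYPE('n)" and ?\<alpha> = "1 - real CARD('n) / p"
  define M where "M = ?C powr p * (((3 + \<epsilon>) / \<epsilon>) ^ CARD('n) * energy p G UNIV)"
  have C: "0 < ?C" using morrey_const_pos[OF p] by simp
  have p1: "1 < p" using p by (rule card_less_imp_one_less)
  have M0: "0 \<le> M" using \<epsilon> energy_nonneg[of p G UNIV] by (simp add: M_def)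
  have main: "(\<Sum>\<^sub>\<infinity>i\<in>I. ennreal_rpow (holder_seminorm ?\<alpha> (ball (x i) r) g) p) \<le> ennreal (M + 1)"
    if r: "0 < r" and disj: "\<forall>i\<in>I. \<forall>j\<in>I. i \<noteq> j \<longrightarrow> ball (x i) (\<epsilon> * r) \<inter> ball (x j) (\<epsilon> * r) = {}"
    for I :: "nat set" and x :: "nat \<Rightarrow> real^'n" and r
  proof -
    have "(\<Sum>i\<in>F. ennreal_rpow (holder_seminorm ?\<alpha> (ball (x i) r) g) p) \<le> ennreal (M + 1)"
      if F: "finite F" "F \<subseteq> I" for F
    proof -
      have "ennreal_rpow (holder_seminorm ?\<alpha> (ball (x i) r) g) p \<le>
          ennreal (?C powr p * energy p G (ball (x i) (3 * r)))" for i
      proof -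
        have "ennreal_rpow (holder_seminorm ?\<alpha> (ball (x i) r) g) p \<le>
           ennreal ((?C * energy p G (ball (x i) (3 * r)) powr (1 / p)) powr p)"
          using C p1 by (intro ennreal_rpow_le holder_seminorm_ball_le[OF p g]) auto
        also have "(?C * energy p G (ball (x i) (3 * r)) powr (1 / p)) powr p =
            ?C powr p * energy p G (ball (x i) (3 * r))"
          using C p1 energy_nonneg[of p G "ball (x i) (3 * r)"]
          by (subst powr_mult) (auto simp: powr_powr)
        finally show ?thesis .
      qed
      then have "(\<Sum>i\<in>F. ennreal_rpow (holder_seminorm ?\<alpha> (ball (x i) r) g) p) \<le>
          (\<Sum>i\<in>F. ennreal (?C powr p * energy p G (ball (x i) (3 * r))))"
        by (intro sum_mono)
      also have "\<dots> = ennreal (?C powr p * (\<Sum>i\<in>F. energy p G (ball (x i) (3 * r))))"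
        by (subst sum_ennreal) (auto simp: sum_distrib_left energy_nonneg)
      also have "\<dots> \<le> ennreal M"
      proof (rule ennreal_leI)
        have "(\<Sum>i\<in>F. energy p G (ball (x i) (3 * r))) \<le>
            ((3 * r + \<epsilon> * r) / (\<epsilon> * r)) ^ CARD('n) * energy p G UNIV"
          by (rule sum_energy_balls_le[OF g(2) F(1)]) (use \<epsilon> r disj F(2) in auto)
        also have "(3 * r + \<epsilon> * r) / (\<epsilon> * r) = (3 + \<epsilon>) / \<epsilon>"
          using r by (simp add: distrib_right[symmetric])
        finally show "?C powr p * (\<Sum>i\<in>F. energy p G (ball (x i) (3 * r))) \<le> M"
          unfolding M_def by (intro mult_left_mono) auto
      qed
      also have "\<dots> \<le> ennreal (M + 1)" by (intro ennreal_leI) simp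
      finally show ?thesis .
    qed
    then show ?thesis
      by (subst nonneg_infsum_complete) (auto intro!: SUP_least)
  qed
  show "\<exists>r\<^sub>E>0. \<exists>C\<^sub>E>0. \<forall>(I :: nat set) x r.
        0 < r \<and> r < r\<^sub>E \<and> ball_cover E I x (\<lambda>_. r) \<and>
        (\<forall>i\<in>I. \<forall>j\<in>I. i \<noteq> j \<longrightarrow> ball (x i) (\<epsilon> * r) \<inter> ball (x j) (\<epsilon> * r) = {}) \<longrightarrow>
        (\<Sum>\<^sub>\<infinity>i\<in>I. ennreal_rpow (holder_seminorm ?\<alpha> (ball (x i) r) g) p) \<le> ennreal C\<^sub>E"
    by (rule exI[of _ 1], simp, rule exI[of _ "M + 1"]) (use M0 main in auto)
qed

section \<open>Existence of the continuous representative\<close>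

text \<open>
  The positive and the negative part of \<open>h\<close> define measures which agree on open boxes, hence are equal; and
  densities are unique almost everywhere.
\<close>

lemma AE_zero_if_box_integrals_zero:
  fixes h :: "'a::euclidean_space \<Rightarrow> real"
  assumes meas: "h \<in> borel_measurable borel"
    and int: "\<And>l u. integrable lborel (\<lambda>x. indicator (box l u) x * h x)"
    and zero: "\<And>l u. (LINT x|lborel. indicator (box l u) x * h x) = 0"
  shows "AE x in lborel. h x = 0"
proof -
  let ?P = "density lborel (\<lambda>x. ennreal (max 0 (h x)))"
  let ?N = "density lborel (\<lambda>x. ennreal (max 0 (- h x)))"
  have em: "emeasure (density lborel (\<lambda>x. ennreal (max 0 (k x)))) (box l u) =
      ennreal (LINT x|lborel. max 0 (indicator (box l u) x * k x))"
    if k: "k \<in> borel_measurable borel" "integrable lborel (\<lambda>x. indicator (box l u) x * k x)" for k l u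
  proof -
    have "emeasure (density lborel (\<lambda>x. ennreal (max 0 (k x)))) (box l u) =
        (\<integral>\<^sup>+x. ennreal (max 0 (k x)) * indicator (box l u) x \<partial>lborel)"
      using k(1) by (intro emeasure_density) auto
    also have "\<dots> = (\<integral>\<^sup>+x. ennreal (max 0 (indicator (box l u) x * k x)) \<partial>lborel)"
      by (intro nn_integral_cong) (auto simp: indicator_def)
    also have "\<dots> = ennreal (LINT x|lborel. max 0 (indicator (box l u) x * k x))"
      using k(2) by (intro nn_integral_eq_integral) auto
    finally show ?thesis .
  qed
  have int': "integrable lborel (\<lambda>x. indicator (box l u) x * - h x)" for l u
    using int[of l u] by simp
  have eq: "emeasure ?P (box l u) = emeasure ?N (box l u)" for l u
  proof -
    have "(LINT x|lborel. max 0 (indicator (box l u) x * h x)) - (LINT x|lborel. max 0 (indicator (box l u) x * - h x)) =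
        (LINT x|lborel. max 0 (indicator (box l u) x * h x) - max 0 (indicator (box l u) x * - h x))"
      using int[of l u] int'[of l u] by (intro Bochner_Integration.integral_diff[symmetric]) auto
    also have "\<dots> = (LINT x|lborel. indicator (box l u) x * h x)"
      by (intro Bochner_Integration.integral_cong) (auto simp: indicator_def)
    finally show ?thesis using zero[of l u] em[OF meas int] em[OF _ int'] meas by simp
  qed
  have "?P = ?N"
  proof (rule measure_eqI_generator_eq)
    let ?E = "range (\<lambda>(a, b). box a b::'a set)"
    show "Int_stable ?E" by (auto simp: Int_stable_def box_Int_box)
    show "?E \<subseteq> Pow UNIV" "sets ?P = sigma_sets UNIV ?E" "sets ?N = sigma_sets UNIV ?E"
      by (simp_all add: borel_eq_box)
    let ?A = "\<lambda>n::nat. box (- (real n *\<^sub>R One)) (real n *\<^sub>R One) :: 'a set"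
    show "range ?A \<subseteq> ?E" "(\<Union>i. ?A i) = UNIV" unfolding UN_box_eq_UNIV by auto
    show "emeasure ?P (?A i) \<noteq> \<infinity>" for i using em[OF meas int] by simp
    show "emeasure ?P X = emeasure ?N X" if "X \<in> ?E" for X using that eq by auto
  qed
  then have "AE x in lborel. ennreal (max 0 (h x)) = ennreal (max 0 (- h x))"
    using meas by (intro sigma_finite_measure.density_unique[OF lborel.sigma_finite_measure_axioms]) auto
  then show ?thesis by eventually_elim (auto simp: max_def split: if_splits)
qed

text \<open>
  Away from the frontier the indicator is locally constant, so a small mollification reproduces it exactly.
\<close>

lemma tendsto_box_mollified:
  fixes y :: "real^'n::finite"
  assumes y: "y \<notin> frontier (box l u)" and \<delta>: "\<And>k. 0 < \<delta> k" "\<delta> \<longlonglongrightarrow> 0"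
  shows "(\<lambda>k. LINT x|lborel. indicator (box l u) x * moll_kernel x (\<delta> k) y) \<longlonglongrightarrow> indicator (box l u) y"
proof -
  have "\<exists>d>0. \<forall>x\<in>cball y d. indicator (box l u) x = (indicator (box l u) y :: real)"
  proof (cases "y \<in> box l u")
    case True
    then obtain d where "0 < d" "cball y d \<subseteq> box l u"
      using open_contains_cball[of "box l u"] open_box by blast
    then show ?thesis using True by (intro exI[of _ d]) (auto simp: indicator_def)
  next
    case False
    then have "y \<in> - closure (box l u)" using y False by (simp add: frontier_def interior_open[OF open_box])
    then obtain d where d: "0 < d" "cball y d \<subseteq> - closure (box l u)"
      using open_contains_cball[of "- closure (box l u)"] by blast
    then have "x \<notin> box l u" if "x \<in> cball y d" for x using that closure_subset by blast
    then show ?thesis using False d(1) by (intro exI[of _ d]) (auto simp: indicator_def)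
  qed
  then obtain d where d: "0 < d" "\<And>x. x \<in> cball y d \<Longrightarrow> indicator (box l u) x = (indicator (box l u) y :: real)"
    by blast
  have "\<forall>\<^sub>F k in sequentially. \<delta> k < d" using order_tendstoD(2)[OF \<delta>(2) d(1)] .
  then have "\<forall>\<^sub>F k in sequentially. (LINT x|lborel. indicator (box l u) x * moll_kernel x (\<delta> k) y) = indicator (box l u) y"
  proof eventually_elim
    case (elim k)
    have eq: "indicator (box l u) x * moll_kernel x (\<delta> k) y = indicator (box l u) y * moll_kernel x (\<delta> k) y" for x
    proof (cases "x \<in> cball y d")
      case False
      then have "y \<notin> cball x (\<delta> k)" using elim by (simp add: dist_commute)
      then have "moll_kernel x (\<delta> k) y = 0" by (rule moll_kernel_eq_0[OF \<delta>(1)])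
      then show ?thesis by simp
    qed (simp add: d(2))
    show ?case unfolding eq by (simp add: integral_moll_kernel(2)[OF \<delta>(1)])
  qed
  then show ?thesis by (rule tendsto_eventually)
qed

lemma measurable_moll_kernel_pair:
  assumes "0 < r"
  shows "(\<lambda>(a, y). moll_kernel (a :: real^'n::finite) r y) \<in> borel_measurable (borel \<Otimes>\<^sub>M borel)"
proof -
  have "continuous_on UNIV (\<lambda>z :: (real^'n) \<times> (real^'n). moll_kernel (fst z) r (snd z))"
    by (intro continuous_on_moll_kernel continuous_intros assms)
  then have "(\<lambda>z :: (real^'n) \<times> (real^'n). moll_kernel (fst z) r (snd z)) \<in> borel_measurable borel"
    by (rule continuous_UNIV_borel)
  then show ?thesis by (simp add: borel_prod case_prod_unfold)
qed

text \<open>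
  The mollification is moved from the function to the indicator of the box.
\<close>

lemma Fubini_mollified_box:
  fixes f :: "real^'n::finite \<Rightarrow> real"
  assumes p: "1 \<le> p" and f: "f \<in> borel_measurable borel" "integrable lborel (\<lambda>x. \<bar>f x\<bar> powr p)" and r: "0 < r"
  shows "(LINT x|lborel. indicator (box l u) x * (LINT y|lborel. f y * moll_kernel x r y)) =
    (LINT y|lborel. f y * (LINT x|lborel. indicator (box l u) x * moll_kernel x r y))"
proof -
  let ?F = "\<lambda>x y. indicator (box l u) x * (f y * moll_kernel x r y)"
  let ?H = "mollifier_bound TYPE('n) / r ^ CARD('n)"
  define C where "C = 1 + ?H * (LINT y|lborel. \<bar>f y\<bar> powr p)"
  note [measurable] = f(1) measurable_moll_kernel_pair[OF r]
  have H: "0 \<le> ?H" using mollifier_bound_pos[where 'n='n] r by simp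
  have inner: "integrable lborel (\<lambda>y. f y * moll_kernel x r y)" for x
    by (rule integrable_Lp_moll_kernel[OF p f r])
  have bound: "(LINT y|lborel. norm (?F x y)) \<le> C * indicator (box l u) x" for x
  proof -
    have "(LINT y|lborel. \<bar>f y * moll_kernel x r y\<bar>) \<le> (LINT y|lborel. moll_kernel x r y + ?H * \<bar>f y\<bar> powr p)"
    proof (rule integral_mono)
      fix y
      have "\<bar>f y\<bar> * moll_kernel x r y \<le> (1 + \<bar>f y\<bar> powr p) * moll_kernel x r y"
        by (intro mult_right_mono abs_le_1_plus_powr p moll_kernel_nonneg r)
      also have "\<dots> \<le> moll_kernel x r y + ?H * \<bar>f y\<bar> powr p"
        using mult_right_mono[OF moll_kernel_le[OF r, of x y], of "\<bar>f y\<bar> powr p"] by (simp add: algebra_simps)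
      finally show "\<bar>f y * moll_kernel x r y\<bar> \<le> moll_kernel x r y + ?H * \<bar>f y\<bar> powr p"
        using moll_kernel_nonneg[OF r, of x y] by (simp add: abs_mult)
    next
      show "integrable lborel (\<lambda>y. moll_kernel x r y + ?H * \<bar>f y\<bar> powr p)"
        by (intro Bochner_Integration.integrable_add integrable_mult_right integrable_moll_kernel r f(2))
    qed (use inner in auto)
    also have "\<dots> = C"
      using integrable_moll_kernel[OF r, of x] f(2) by (simp add: C_def integral_moll_kernel(1)[OF r])
    finally show ?thesis by (auto simp: indicator_def)
  qed
  have "integrable (lborel \<Otimes>\<^sub>M lborel) (case_prod ?F)"
  proof (rule lborel_pair.Fubini_integrable)
    show meas: "case_prod ?F \<in> borel_measurable (lborel \<Otimes>\<^sub>M lborel)"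
      by measurable
    show "integrable lborel (\<lambda>x. LINT y|lborel. norm (case_prod ?F (x, y)))"
    proof (rule Bochner_Integration.integrable_bound[where f = "\<lambda>x. C * indicator (box l u) x"])
      show "integrable lborel (\<lambda>x. C * indicator (box l u) x)"
        using emeasure_lborel_box_finite[of l u] by (intro integrable_mult_right integrable_real_indicator) auto
      show "(\<lambda>x. LINT y|lborel. norm (case_prod ?F (x, y))) \<in> borel_measurable lborel"
        by (rule lborel.borel_measurable_lebesgue_integral) (use meas in measurable)
      show "AE x in lborel. norm (LINT y|lborel. norm (case_prod ?F (x, y))) \<le> norm (C * indicator (box l u) x)"
      proof (rule AE_I2)
        fix x
        have "0 \<le> (LINT y|lborel. norm (?F x y))" by (rule integral_nonneg_AE) simp
        then show "norm (LINT y|lborel. norm (case_prod ?F (x, y))) \<le> norm (C * indicator (box l u) x)"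
          using bound[of x] by simp
      qed
    qed
    show "AE x in lborel. integrable lborel (\<lambda>y. case_prod ?F (x, y))"
      using inner by (intro AE_I2) (simp add: integrable_mult_right)
  qed
  from lborel_pair.Fubini_integral[OF this]
  have "(LINT y|lborel. LINT x|lborel. ?F x y) = (LINT x|lborel. LINT y|lborel. ?F x y)" .
  moreover have "(LINT x|lborel. LINT y|lborel. ?F x y) =
      (LINT x|lborel. indicator (box l u) x * (LINT y|lborel. f y * moll_kernel x r y))" by simp
  moreover have "(LINT y|lborel. LINT x|lborel. ?F x y) =
      (LINT y|lborel. f y * (LINT x|lborel. indicator (box l u) x * moll_kernel x r y))"
    by (simp add: mult.left_commute[of _ "f _"])
  ultimately show ?thesis by simp
qed

lemma continuous_mollified:
  fixes f :: "real^'n::finite \<Rightarrow> real"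
  assumes p: "1 \<le> p" and f: "f \<in> borel_measurable borel" "integrable lborel (\<lambda>x. \<bar>f x\<bar> powr p)" and r: "0 < r"
  shows "continuous_on UNIV (\<lambda>x. LINT y|lborel. f y * moll_kernel x r y)"
proof (rule continuous_on_sequentiallyI)
  fix X and a :: "real^'n" assume "X \<longlonglongrightarrow> a"
  let ?H = "mollifier_bound TYPE('n) / r ^ CARD('n)"
  have H: "0 \<le> ?H" using mollifier_bound_pos[where 'n='n] r by simp
  have "Bseq X" using \<open>X \<longlonglongrightarrow> a\<close> by (intro convergent_imp_Bseq) (auto simp: convergent_def)
  then obtain R where R: "\<And>k. norm (X k) \<le> R" by (auto simp: Bseq_def)
  show "(\<lambda>k. LINT y|lborel. f y * moll_kernel (X k) r y) \<longlonglongrightarrow> (LINT y|lborel. f y * moll_kernel a r y)"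
  proof (rule integral_dominated_convergence[where w = "\<lambda>y. \<bar>f y\<bar> * (?H * indicator (cball 0 (R + r)) y)"])
    show "integrable lborel (\<lambda>y. \<bar>f y\<bar> * (?H * indicator (cball 0 (R + r)) y))"
      by (rule integrable_locally_Lp[OF p, where M = ?H and c = 0 and R = "R + r"])
         (use f H in \<open>auto simp: indicator_def\<close>)
    show "AE y in lborel. (\<lambda>k. f y * moll_kernel (X k) r y) \<longlonglongrightarrow> f y * moll_kernel a r y"
    proof (intro AE_I2 tendsto_mult tendsto_const)
      fix y :: "real^'n"
      have "continuous_on UNIV (\<lambda>a. moll_kernel a r y)"
        by (intro continuous_on_moll_kernel continuous_intros r)
      then show "(\<lambda>k. moll_kernel (X k) r y) \<longlonglongrightarrow> moll_kernel a r y"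
        using \<open>X \<longlonglongrightarrow> a\<close> by (auto intro: continuous_on_tendsto_compose)
    qed
    show "AE y in lborel. norm (f y * moll_kernel (X k) r y) \<le> \<bar>f y\<bar> * (?H * indicator (cball 0 (R + r)) y)" for k
    proof (rule AE_I2)
      fix y
      have "moll_kernel (X k) r y \<le> ?H * indicator (cball 0 (R + r)) y"
      proof (cases "y \<in> cball (X k) r")
        case True
        then have "norm y \<le> R + r"
          using R[of k] norm_triangle_sub[of y "X k"] by (simp add: dist_norm norm_minus_commute)
        then show ?thesis using moll_kernel_le[OF r, of "X k" y] by simp
      next
        case False
        then have "moll_kernel (X k) r y = 0" by (rule moll_kernel_eq_0[OF r])
        then show ?thesis using H by (auto simp: indicator_def)
      qed
      then have "\<bar>f y\<bar> * moll_kernel (X k) r y \<le> \<bar>f y\<bar> * (?H * indicator (cball 0 (R + r)) y)"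
        by (rule mult_left_mono) simp
      then show "norm (f y * moll_kernel (X k) r y) \<le> \<bar>f y\<bar> * (?H * indicator (cball 0 (R + r)) y)"
        unfolding real_norm_def abs_mult abs_of_nonneg[OF moll_kernel_nonneg[OF r]] .
    qed
  qed (use integrable_Lp_moll_kernel[OF p f r] in \<open>auto intro: borel_measurable_integrable\<close>)
qed

text \<open>
  The estimate between two scales holds uniformly in the centre, so the mollifications form a uniformly Cauchy
  sequence and their limit is continuous. It equals \<open>f\<close> almost everywhere because both have the same integrals over
  boxes.
\<close>

lemma weak_gradient_continuous_rep:
  fixes f :: "real^'n::finite \<Rightarrow> real"
  assumes p: "real CARD('n) < p" and f: "weak_gradient p f G"
  shows "\<exists>g. continuous_on UNIV g \<and> (AE x in lborel. g x = f x)"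
proof -
  let ?\<alpha> = "1 - real CARD('n) / p"
  have p1: "1 < p" using p by (rule card_less_imp_one_less)
  have \<alpha>: "0 < ?\<alpha>" using p p1 by simp
  have fm: "f \<in> borel_measurable borel" "integrable lborel (\<lambda>x. \<bar>f x\<bar> powr p)"
    using f by (auto simp: weak_gradient_def)
  define \<delta> where "\<delta> k = 1 / real (Suc k)" for k
  have \<delta>: "0 < \<delta> k" for k by (simp add: \<delta>_def)
  have \<delta>0: "\<delta> \<longlonglongrightarrow> 0" unfolding \<delta>_def by (rule LIMSEQ_Suc[OF lim_1_over_n])
  define A where "A k x = (LINT y|lborel. f y * moll_kernel x (\<delta> k) y)" for k x
  define K where "K = morrey_const p TYPE('n) * energy p G UNIV powr (1 / p)"
  have K0: "0 \<le> K" using morrey_const_pos[OF p] by (simp add: K_def)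
  have A_cont: "continuous_on UNIV (A k)" for k
    unfolding A_def[abs_def] by (rule continuous_mollified[OF less_imp_le[OF p1] fm \<delta>])
  \<comment> \<open>The offset is zero and the base radius one, so that the parameter of the homothety is the
      mollification radius.\<close>
  have diff: "\<bar>A k x - A m x\<bar> \<le> K * \<delta> k powr ?\<alpha>" if "k < m" for k m x
  proof -
    have "\<delta> m < \<delta> k" using that by (simp add: \<delta>_def frac_less2)
    then have "\<bar>A k x - A m x\<bar> \<le> K * (\<delta> k powr ?\<alpha> - \<delta> m powr ?\<alpha>)"
      using homothety_difference_le[OF p f zero_less_one, of 0 "\<delta> m" "\<delta> k" UNIV x] \<delta>[of m]
      by (simp add: A_def K_def)
    also have "\<dots> \<le> K * \<delta> k powr ?\<alpha>" using K0 by (intro mult_left_mono) auto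
    finally show ?thesis .
  qed
  have "(\<lambda>k. K * \<delta> k powr ?\<alpha>) \<longlonglongrightarrow> K * 0 powr ?\<alpha>"
    using \<alpha> by (intro tendsto_mult tendsto_const tendsto_powr' \<delta>0) (auto simp: less_imp_le[OF \<delta>])
  then have lim: "(\<lambda>k. K * \<delta> k powr ?\<alpha>) \<longlonglongrightarrow> 0" by simp
  have "uniformly_convergent_on UNIV A"
  proof (intro Cauchy_uniformly_convergent uniformly_Cauchy_onI')
    fix e :: real assume "0 < e"
    then obtain N where N: "\<And>k. N \<le> k \<Longrightarrow> K * \<delta> k powr ?\<alpha> < e"
      using order_tendstoD(2)[OF lim] by (auto simp: eventually_sequentially)
    have "dist (A m x) (A n x) < e" if "N \<le> m" "m < n" for x m n
      using le_less_trans[OF diff[OF that(2)] N[OF that(1)]] by (simp add: dist_real_def)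
    then show "\<exists>M. \<forall>x\<in>UNIV. \<forall>m\<ge>M. \<forall>n>m. dist (A m x) (A n x) < e"
      by blast
  qed
  then obtain g where g: "uniform_limit UNIV A g sequentially"
    by (auto simp: uniformly_convergent_on_def)
  have g_cont: "continuous_on UNIV g"
    by (rule uniform_limit_theorem[OF _ g]) (auto simp: A_cont)
  note [measurable] = continuous_UNIV_borel[OF g_cont] fm(1) continuous_UNIV_borel[OF A_cont]
  have locf: "integrable lborel (\<lambda>x. f x * h x)"
    if "h \<in> borel_measurable borel" "\<And>x. \<bar>h x\<bar> \<le> 1" "\<And>x. x \<notin> cball 0 R \<Longrightarrow> h x = 0" for h R
    by (rule integrable_locally_Lp[OF less_imp_le[OF p1] fm that])
  have locg: "integrable lborel (\<lambda>x. indicator (box l u) x * g x)" for l u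
  proof -
    have "integrable lborel (\<lambda>x. indicator (cbox l u) x *\<^sub>R g x)"
      by (rule borel_integrable_compact) (auto intro: continuous_on_subset[OF g_cont])
    then have "integrable lborel (\<lambda>x. indicator (box l u) x *\<^sub>R (indicator (cbox l u) x *\<^sub>R g x))"
      by (rule integrable_mult_indicator[rotated]) simp
    moreover have "(\<lambda>x. indicator (box l u) x *\<^sub>R (indicator (cbox l u) x *\<^sub>R g x)) =
        (\<lambda>x. indicator (box l u) x * g x)"
      using box_subset_cbox[of l u] by (auto simp: indicator_def fun_eq_iff)
    ultimately show ?thesis by simp
  qed
  have "(LINT x|lborel. indicator (box l u) x * f x) = (LINT x|lborel. indicator (box l u) x * g x)" for l u
  proof -
    obtain R where R: "box l u \<subseteq> cball 0 R"
      using bounded_box[of l u] by (auto simp: bounded_iff subset_iff)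
    define J where "J k y = (LINT x|lborel. indicator (box l u) x * moll_kernel x (\<delta> k) y)" for k y
    have "(\<lambda>k. LINT x|lborel. indicator (box l u) x * A k x) \<longlonglongrightarrow> (LINT x|lborel. indicator (box l u) x * g x)"
    proof (rule integral_dominated_convergence[where
          w = "\<lambda>x. \<bar>indicator (box l u) x * g x\<bar> + K * indicator (box l u) x"])
      show "AE x in lborel. (\<lambda>k. indicator (box l u) x * A k x) \<longlonglongrightarrow> indicator (box l u) x * g x"
        by (intro AE_I2 tendsto_mult tendsto_const tendsto_uniform_limitI[OF g]) auto
      show "integrable lborel (\<lambda>x. \<bar>indicator (box l u) x * g x\<bar> + K * indicator (box l u) x)"
        using emeasure_lborel_box_finite[of l u]
        by (intro Bochner_Integration.integrable_add integrable_abs locg integrable_mult_right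
            integrable_real_indicator) auto
      \<comment> \<open>The Cauchy estimate survives in the limit, so all \<open>A k\<close> are within \<open>K\<close> of
          \<open>g\<close>.\<close>
      show "AE x in lborel. norm (indicator (box l u) x * A k x) \<le> \<bar>indicator (box l u) x * g x\<bar> + K * indicator (box l u) x" for k
      proof (rule AE_I2)
        fix x
        have "\<bar>A k x - g x\<bar> \<le> K * \<delta> k powr ?\<alpha>"
        proof (rule tendsto_upperbound)
          show "(\<lambda>m. \<bar>A k x - A m x\<bar>) \<longlonglongrightarrow> \<bar>A k x - g x\<bar>"
            by (intro tendsto_intros tendsto_uniform_limitI[OF g]) auto
          show "\<forall>\<^sub>F m in sequentially. \<bar>A k x - A m x\<bar> \<le> K * \<delta> k powr ?\<alpha>"
            using eventually_gt_at_top[of k] by eventually_elim (rule diff)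
        qed simp
        also have "\<dots> \<le> K * 1"
          using K0 \<alpha> by (intro mult_left_mono powr_le1) (auto simp: \<delta>_def)
        finally show "norm (indicator (box l u) x * A k x) \<le> \<bar>indicator (box l u) x * g x\<bar> + K * indicator (box l u) x"
          by (auto simp: indicator_def)
      qed
    qed measurable
    moreover have "(LINT x|lborel. indicator (box l u) x * A k x) = (LINT y|lborel. f y * J k y)" for k
      unfolding A_def J_def by (rule Fubini_mollified_box[OF less_imp_le[OF p1] fm \<delta>])
    ultimately have lim_g: "(\<lambda>k. LINT y|lborel. f y * J k y) \<longlonglongrightarrow> (LINT x|lborel. indicator (box l u) x * g x)"
      by simp
    have J_meas: "J k \<in> borel_measurable borel" for k
    proof -
      note [measurable] = measurable_moll_kernel_pair[OF \<delta>[of k]]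
      have [measurable]: "(\<lambda>(y, x). moll_kernel (x :: real^'n) (\<delta> k) y) \<in> borel_measurable (borel \<Otimes>\<^sub>M borel)"
        by measurable
      have "(\<lambda>y. LINT x|lborel. indicator (box l u) x * moll_kernel x (\<delta> k) y) \<in> borel_measurable borel"
        by (rule lborel.borel_measurable_lebesgue_integral) measurable
      then show ?thesis by (simp add: J_def[abs_def])
    qed
    have ker_int: "integrable lborel (\<lambda>x. moll_kernel x (\<delta> k) y)" for k and y :: "real^'n"
      by (rule integrable_continuous_compact_support[of _ y "\<delta> k"])
         (auto intro!: continuous_on_moll_kernel continuous_intros \<delta> moll_kernel_eq_0 simp: dist_commute)
    have J_bound: "\<bar>J k y\<bar> \<le> indicator (cball 0 (R + 1)) y" for k y
    proof (cases "y \<in> cball 0 (R + 1)")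
      case True
      have "\<bar>J k y\<bar> \<le> (LINT x|lborel. \<bar>indicator (box l u) x * moll_kernel x (\<delta> k) y\<bar>)"
        unfolding J_def by (rule integral_abs_bound)
      also have "\<dots> \<le> (LINT x|lborel. moll_kernel x (\<delta> k) y)"
      proof (rule integral_mono)
        show "integrable lborel (\<lambda>x. \<bar>indicator (box l u) x * moll_kernel x (\<delta> k) y\<bar>)"
          using integrable_mult_indicator[OF _ ker_int, of "box l u" k y] by (intro integrable_abs) simp
        show "\<bar>indicator (box l u) x * moll_kernel x (\<delta> k) y\<bar> \<le> moll_kernel x (\<delta> k) y" for x
          using moll_kernel_nonneg[OF \<delta>] by (auto simp: indicator_def)
      qed (rule ker_int)
      also have "\<dots> = 1" by (rule integral_moll_kernel(2)[OF \<delta>])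
      finally show ?thesis using True by simp
    next
      case False
      have zero: "indicator (box l u) x * moll_kernel x (\<delta> k) y = 0" for x
      proof (cases "x \<in> box l u")
        case True
        then have "norm x \<le> R" using R by auto
        moreover have "\<delta> k \<le> 1" by (simp add: \<delta>_def)
        ultimately have "y \<notin> cball x (\<delta> k)"
          using False norm_triangle_sub[of y x] by (auto simp: dist_norm norm_minus_commute)
        then show ?thesis by (simp add: moll_kernel_eq_0[OF \<delta>])
      qed simp
      show ?thesis unfolding J_def zero by simp
    qed
    have "(\<lambda>k. LINT y|lborel. f y * J k y) \<longlonglongrightarrow> (LINT y|lborel. f y * indicator (box l u) y)"
    proof (rule integral_dominated_convergence[where w = "\<lambda>y. \<bar>f y * indicator (cball 0 (R + 1)) y\<bar>"])
      show "integrable lborel (\<lambda>y. \<bar>f y * indicator (cball 0 (R + 1)) y\<bar>)"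
        by (intro integrable_abs locf[of _ "R + 1"]) (auto simp: indicator_def)
      have "frontier (box l u) \<in> null_sets lebesgue"
        using negligible_convex_frontier[of "box l u"] by (simp add: negligible_iff_null_sets convex_box)
      then have "frontier (box l u) \<in> null_sets lborel"
        by (simp add: null_sets_completion_iff)
      then have "AE y in lborel. y \<notin> frontier (box l u)" by (rule AE_not_in)
      then show "AE y in lborel. (\<lambda>k. f y * J k y) \<longlonglongrightarrow> f y * indicator (box l u) y"
        by eventually_elim (auto simp: J_def intro!: tendsto_intros tendsto_box_mollified \<delta> \<delta>0)
      show "AE y in lborel. norm (f y * J k y) \<le> \<bar>f y * indicator (cball 0 (R + 1)) y\<bar>" for k
        using J_bound[of k] by (intro AE_I2) (auto simp: abs_mult intro!: mult_left_mono)
    qed (use J_meas in measurable)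
    from LIMSEQ_unique[OF this lim_g] show ?thesis by (simp add: mult.commute)
  qed
  moreover have locf': "integrable lborel (\<lambda>x. indicator (box l u) x * f x)" for l u
  proof -
    obtain R where R: "box l u \<subseteq> cball 0 R"
      using bounded_box[of l u] by (auto simp: bounded_iff subset_iff)
    have "integrable lborel (\<lambda>x. f x * indicator (box l u) x)"
    proof (rule locf[of _ R])
      show "indicator (box l u) x = (0 :: real)" if "x \<notin> cball 0 R" for x
        using R that by (auto simp: indicator_def)
    qed (auto simp: indicator_def)
    then show ?thesis by (simp add: mult.commute)
  qed
  ultimately have "AE x in lborel. g x - f x = 0"
    using locg by (intro AE_zero_if_box_integrals_zero)
      (auto simp: right_diff_distrib intro!: Bochner_Integration.integrable_diff)
  then show ?thesis using g_cont by (intro exI[of _ g]) auto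
qed

section \<open>Sobolev functions and Borel weak gradients\<close>

lemma Lp_borel_rep:
  assumes "f \<in> Lp p"
  obtains g where "g \<in> borel_measurable borel" "AE x in lborel. f x = g x"
    "integrable lborel (\<lambda>x. \<bar>g x\<bar> powr p)"
proof -
  have f: "f \<in> borel_measurable lebesgue" "integrable lebesgue (\<lambda>x. \<bar>f x\<bar> powr p)"
    using assms by (auto simp: Lp_def)
  obtain g where g: "g \<in> borel_measurable lborel" "AE x in lborel. f x = g x"
    using completion_ex_borel_measurable_real[OF f(1)] by blast
  have "AE x in lebesgue. f x = g x" using g(2) by (rule AE_completion)
  moreover have "g \<in> borel_measurable lebesgue" using g(1) by (rule measurable_completion)
  ultimately have "integrable lebesgue (\<lambda>x. \<bar>g x\<bar> powr p)"
    using f by (subst integrable_cong_AE[where g = "\<lambda>x. \<bar>f x\<bar> powr p"]) auto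
  then have "integrable lborel (\<lambda>x. \<bar>g x\<bar> powr p)"
    using g(1) by (subst (asm) integrable_completion) auto
  then show ?thesis using g by (intro that) auto
qed

lemma integral_lebesgue_eq_lborel:
  fixes f g h :: "'a::euclidean_space \<Rightarrow> real"
  assumes "f \<in> borel_measurable lebesgue" "g \<in> borel_measurable borel" "h \<in> borel_measurable borel"
    "AE x in lborel. f x = g x"
  shows "(LINT x|lebesgue. f x * h x) = (LINT x|lborel. g x * h x)"
proof -
  have h: "h \<in> borel_measurable lebesgue" and g: "g \<in> borel_measurable lebesgue"
    using assms(2,3) by (auto intro!: measurable_completion)
  have "AE x in lebesgue. f x = g x" using assms(4) by (rule AE_completion)
  then have "(LINT x|lebesgue. f x * h x) = (LINT x|lebesgue. g x * h x)"
    using assms(1) g h by (intro integral_cong_AE) auto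
  also have "\<dots> = (LINT x|lborel. g x * h x)"
    using assms(2,3) by (intro integral_completion) auto
  finally show ?thesis .
qed

text \<open>
  Completed measurability is removed by changing the weak derivatives on null sets. Any Borel
  representative, in particular a continuous one, may be taken for the function itself.
\<close>

lemma W1p_weak_gradient:
  fixes f :: "real^'n::finite \<Rightarrow> real"
  assumes f: "f \<in> W1p p" and g: "g \<in> borel_measurable borel" "AE x in lborel. g x = f x"
  shows "\<exists>G. weak_gradient p g G"
proof -
  have fL: "f \<in> borel_measurable lebesgue" "f \<in> Lp p" using f by (auto simp: W1p_def Lp_def)
  have fg: "AE x in lborel. f x = g x" using g(2) by eventually_elim simp
  define P where "P i G \<longleftrightarrow> G \<in> borel_measurable borel \<and> integrable lborel (\<lambda>x. \<bar>G x\<bar> powr p) \<and>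
      (\<forall>\<phi>. test_function \<phi> \<longrightarrow> (LINT x|lborel. g x * partial_deriv i \<phi> x) = - (LINT x|lborel. G x * \<phi> x))"
    for i G
  have "\<exists>G. P i G" for i
  proof -
    obtain gi where gi: "gi \<in> Lp p" "weak_partial_deriv i f gi" using f by (auto simp: W1p_def)
    obtain G where G: "G \<in> borel_measurable borel" "AE x in lborel. gi x = G x"
      "integrable lborel (\<lambda>x. \<bar>G x\<bar> powr p)"
      by (rule Lp_borel_rep[OF gi(1)])
    have gi_meas: "gi \<in> borel_measurable lebesgue" using gi(1) by (simp add: Lp_def)
    have "(LINT x|lborel. g x * partial_deriv i \<phi> x) = - (LINT x|lborel. G x * \<phi> x)"
      if \<phi>: "test_function \<phi>" for \<phi>
    proof -
      note m = test_function_continuous(1,2)[OF \<phi>, THEN continuous_UNIV_borel]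
      have "(LINT x|lebesgue. f x * partial_deriv i \<phi> x) = - (LINT x|lebesgue. gi x * \<phi> x)"
        using gi(2) \<phi> by (simp add: weak_partial_deriv_def)
      then show ?thesis
        unfolding integral_lebesgue_eq_lborel[OF fL(1) g(1) m(2) fg]
          integral_lebesgue_eq_lborel[OF gi_meas G(1) m(1) G(2)] .
    qed
    then show ?thesis using G unfolding P_def by (intro exI[of _ G]) simp
  qed
  then obtain G where G: "\<And>i. P i (G i)" by metis
  have "integrable lborel (\<lambda>x. \<bar>g x\<bar> powr p)"
  proof -
    obtain g' where g': "g' \<in> borel_measurable borel" "AE x in lborel. f x = g' x"
      "integrable lborel (\<lambda>x. \<bar>g' x\<bar> powr p)"
      by (rule Lp_borel_rep[OF fL(2)])
    have "AE x in lborel. g x = g' x" using fg g'(2) by eventually_elim simp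
    then show ?thesis using g'(1,3) g(1)
      by (subst integrable_cong_AE[where g = "\<lambda>x. \<bar>g' x\<bar> powr p"]) auto
  qed
  then have "weak_gradient p g G" using G g(1) by (simp add: weak_gradient_def P_def)
  then show ?thesis by (rule exI[of _ G])
qed

lemma weak_gradient_imp_W1p:
  fixes f :: "real^'n::finite \<Rightarrow> real"
  assumes "weak_gradient p f G"
  shows "f \<in> W1p p"
proof -
  have Lp: "h \<in> Lp p" if "h \<in> borel_measurable borel" "integrable lborel (\<lambda>x. \<bar>h x\<bar> powr p)"
    for h :: "real^'n \<Rightarrow> real"
    using that by (auto simp: Lp_def integrable_completion intro!: measurable_completion)
  have f: "f \<in> borel_measurable borel" "f \<in> Lp p"
    using assms Lp by (auto simp: weak_gradient_def)
  have "\<exists>g\<in>Lp p. weak_partial_deriv i f g" for i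
  proof
    have G: "G i \<in> borel_measurable borel" using assms by (auto simp: weak_gradient_def)
    show "G i \<in> Lp p" using assms Lp by (auto simp: weak_gradient_def)
    show "weak_partial_deriv i f (G i)"
      unfolding weak_partial_deriv_def
    proof (intro allI impI)
      fix \<phi> :: "real^'n \<Rightarrow> real" assume \<phi>: "test_function \<phi>"
      note m = test_function_continuous(1,2)[OF \<phi>, THEN continuous_UNIV_borel]
      have "(LINT x|lborel. f x * partial_deriv i \<phi> x) = - (LINT x|lborel. G i x * \<phi> x)"
        using assms \<phi> by (auto simp: weak_gradient_def)
      then show "(LINT x|lebesgue. f x * partial_deriv i \<phi> x) = - (LINT x|lebesgue. G i x * \<phi> x)"
        using f(1) G m by (simp add: integral_lebesgue_eq_lborel measurable_completion)
    qed
  qed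
  then show ?thesis using f(2) by (simp add: W1p_def)
qed

section \<open>Integration by parts\<close>

lemma partial_deriv_line:
  fixes F :: "real^'n::finite \<Rightarrow> real"
  assumes "F differentiable_on UNIV"
  shows "((\<lambda>t. F (x + t *\<^sub>R axis i 1)) has_real_derivative partial_deriv i F (x + t *\<^sub>R axis i 1)) (at t)"
proof -
  let ?D = "frechet_derivative F (at (x + t *\<^sub>R axis i 1))"
  have lin: "linear ?D" by (rule has_derivative_linear[OF has_derivative_frechet[OF assms]])
  have "((\<lambda>t. F (x + t *\<^sub>R axis i 1)) has_derivative (\<lambda>h. ?D (h *\<^sub>R axis i 1))) (at t)"
    by (rule has_derivative_compose[OF _ has_derivative_frechet[OF assms]]) (auto intro!: derivative_eq_intros)
  then show ?thesis
    by (simp add: has_field_derivative_def linear_scale[OF lin] partial_deriv_def mult.commute[of _ "?D _"])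
qed

text \<open>
  By translation invariance every difference quotient of \<open>F\<close> has integral \<open>0\<close>, and the quotients converge
  dominatedly because \<open>F\<close> is Lipschitz along the axis with compact support.
\<close>

lemma integral_partial_deriv_eq_0:
  fixes F :: "real^'n::finite \<Rightarrow> real"
  assumes F: "C_class (Suc 0) F" and supp: "\<And>x. R \<le> norm x \<Longrightarrow> F x = 0"
  shows "(LINT x|lborel. partial_deriv i F x) = 0"
proof -
  have d: "F differentiable_on UNIV" and c: "continuous_on UNIV (partial_deriv i F)" and cF: "continuous_on UNIV F"
    using F C_class_continuous[OF F] by simp_all
  note [measurable] = continuous_UNIV_borel[OF c] continuous_UNIV_borel[OF cF]
  have supp': "partial_deriv i F x = 0" if "R + 1 \<le> norm x" for x
    by (rule partial_deriv_eq_0[of "- cball 0 R"]) (use supp that in auto)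
  obtain D where D: "\<And>x. \<bar>partial_deriv i F x\<bar> \<le> D"
    using continuous_compact_support_bounded[OF c supp'] by auto
  define h where "h k = 1 / real (Suc k)" for k
  have h: "0 < h k" "h k \<le> 1" for k by (simp_all add: h_def)
  have h0: "h \<longlonglongrightarrow> 0" unfolding h_def by (rule LIMSEQ_Suc[OF lim_1_over_n])
  let ?q = "\<lambda>k x. (F (x + h k *\<^sub>R axis i 1) - F x) / h k"
  have intF: "integrable lborel F"
    by (rule integrable_continuous_compact_support[OF cF, of 0 R]) (auto intro: supp)
  have shift: "F (a + x) = 0" if "x \<notin> cball (- a) R" for a x
    using that by (intro supp) (simp add: dist_norm norm_minus_commute add.commute)
  have q0: "(LINT x|lborel. ?q k x) = 0" for k
  proof -
    have "integrable lborel (\<lambda>x. F (h k *\<^sub>R axis i 1 + x))"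
      by (rule integrable_continuous_compact_support[of _ "- (h k *\<^sub>R axis i 1)" R])
         (auto intro!: continuous_on_compose2[OF cF] continuous_intros shift)
    moreover have "(LINT x|lborel. F (h k *\<^sub>R axis i 1 + x)) = (LINT x|lborel. F x)"
      using lborel_integral_affine[of 1 F "h k *\<^sub>R axis i 1"] by simp
    ultimately show ?thesis using intF by (simp add: add.commute)
  qed
  have "(\<lambda>k. LINT x|lborel. ?q k x) \<longlonglongrightarrow> (LINT x|lborel. partial_deriv i F x)"
  proof (rule integral_dominated_convergence[where w = "\<lambda>x. D * indicator (cball 0 (R + 1)) x"])
    show "integrable lborel (\<lambda>x. D * indicator (cball 0 (R + 1)) x)"
      using emeasure_lborel_cball_finite[of 0 "R + 1"]
      by (intro integrable_mult_right integrable_real_indicator) auto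
    show "AE x in lborel. (\<lambda>k. ?q k x) \<longlonglongrightarrow> partial_deriv i F x"
    proof (rule AE_I2)
      fix x
      have "((\<lambda>t. (F (x + t *\<^sub>R axis i 1) - F x) / t) \<longlongrightarrow> partial_deriv i F x) (at 0)"
        using partial_deriv_line[OF d, of x i 0] by (simp add: has_field_derivative_iff)
      then show "(\<lambda>k. ?q k x) \<longlonglongrightarrow> partial_deriv i F x"
        by (rule filterlim_compose[of _ _ "at 0"])
           (use h0 h(1) in \<open>auto simp: filterlim_at less_imp_neq[symmetric] intro!: always_eventually\<close>)
    qed
    show "AE x in lborel. norm (?q k x) \<le> D * indicator (cball 0 (R + 1)) x" for k
    proof (rule AE_I2)
      fix x
      show "norm (?q k x) \<le> D * indicator (cball 0 (R + 1)) x"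
      proof (cases "norm x \<le> R + 1")
        case True
        have "norm (F (x + h k *\<^sub>R axis i 1) - F (x + 0 *\<^sub>R axis i 1)) \<le> D * norm (h k - 0)"
          by (rule field_differentiable_bound[of UNIV "\<lambda>t. F (x + t *\<^sub>R axis i 1)"
                "\<lambda>t. partial_deriv i F (x + t *\<^sub>R axis i 1)"])
             (use partial_deriv_line[OF d] D in auto)
        then show ?thesis using True h[of k] by (simp add: pos_divide_le_eq)
      next
        case False
        have "norm x \<le> norm (x + h k *\<^sub>R axis i (1::real)) + norm (h k *\<^sub>R axis i (1::real))"
          by (metis add_diff_cancel norm_triangle_ineq4)
        then have "R \<le> norm (x + h k *\<^sub>R axis i 1)" using False h[of k] by simp
        then show ?thesis using supp[of x] supp[of "x + h k *\<^sub>R axis i 1"] False by simp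
      qed
    qed
  qed measurable
  then show ?thesis unfolding q0 by (simp add: LIMSEQ_const_iff)
qed

lemma integration_by_parts:
  fixes F :: "real^'n::finite \<Rightarrow> real"
  assumes F: "C_class (Suc 0) F" and \<phi>: "test_function \<phi>"
  shows "integrable lborel (\<lambda>x. F x * partial_deriv i \<phi> x)"
    and "integrable lborel (\<lambda>x. partial_deriv i F x * \<phi> x)"
    and "(LINT x|lborel. F x * partial_deriv i \<phi> x) = - (LINT x|lborel. partial_deriv i F x * \<phi> x)"
proof -
  obtain R where R: "\<And>x. R \<le> norm x \<Longrightarrow> \<phi> x = 0" "\<And>x i. R \<le> norm x \<Longrightarrow> partial_deriv i \<phi> x = 0"
    using test_function_support[OF \<phi>] by auto
  note c\<phi> = test_function_continuous[OF \<phi>]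
  have d: "F differentiable_on UNIV" and c: "continuous_on UNIV (partial_deriv i F)" and cF: "continuous_on UNIV F"
    using F C_class_continuous[OF F] by simp_all
  show 1: "integrable lborel (\<lambda>x. F x * partial_deriv i \<phi> x)"
    by (rule integrable_continuous_compact_support[of _ 0 R]) (auto intro!: continuous_intros cF c\<phi> simp: R)
  show 2: "integrable lborel (\<lambda>x. partial_deriv i F x * \<phi> x)"
    by (rule integrable_continuous_compact_support[of _ 0 R]) (auto intro!: continuous_intros c c\<phi> simp: R)
  have "partial_deriv i (\<lambda>x. F x * \<phi> x) x = F x * partial_deriv i \<phi> x + partial_deriv i F x * \<phi> x" for x
    by (rule partial_deriv_eq[OF has_derivative_mult[OF has_derivative_frechet[OF d] has_derivative_frechet[OF c\<phi>(3)]], THEN trans])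
       (simp add: partial_deriv_def)
  moreover have "C_class (Suc 0) \<phi>" using \<phi> unfolding test_function_def by blast
  then have "(LINT x|lborel. partial_deriv i (\<lambda>x. F x * \<phi> x) x) = 0"
    by (intro integral_partial_deriv_eq_0[of _ R] C_class_mult F) (auto simp: R)
  ultimately have "(LINT x|lborel. F x * partial_deriv i \<phi> x + partial_deriv i F x * \<phi> x) = 0" by simp
  then show "(LINT x|lborel. F x * partial_deriv i \<phi> x) = - (LINT x|lborel. partial_deriv i F x * \<phi> x)"
    using 1 2 by simp
qed

section \<open>A Sobolev function with a lacunary sequence of spikes\<close>

text \<open>
  The spike of index \<open>m\<close> lives in the ball of radius \<open>(1/8) ^ depth p m\<close> and its Hoelder seminorm is of order
  \<open>(1/4) ^ m\<close>. This depth makes \<open>depth p m\<close> times the \<open>p\<close>-th power of \<open>(1/4) ^ m\<close> at least \<open>m + 1\<close>,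
  hence unbounded.
\<close>

definition depth :: "real \<Rightarrow> nat \<Rightarrow> nat" where
  "depth p m = nat \<lceil>(real m + 1) * 4 powr (real m * p)\<rceil>"

definition radius :: "real \<Rightarrow> nat \<Rightarrow> real" where
  "radius p m = (1 / 8) ^ depth p m"

text \<open>
  The power of the radius is the scaling under which both the Hoelder seminorm of exponent \<open>1 - n / p\<close> and the
  \<open>L\<^sup>p\<close> norm of the gradient are invariant.
\<close>

definition spike :: "real \<Rightarrow> nat \<Rightarrow> real^'n::finite \<Rightarrow> real" where
  "spike p m x = (1 / 4) ^ m * radius p m powr (1 - real CARD('n) / p) * bump ((1 / radius p m) *\<^sub>R x)"

definition spike_sum :: "real \<Rightarrow> real^'n::finite \<Rightarrow> real" where
  "spike_sum p x = (\<Sum>m. spike p m x)"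

lemma depth_ge: "(real m + 1) * 4 powr (real m * p) \<le> real (depth p m)"
  unfolding depth_def by (rule real_nat_ceiling_ge)

lemma Suc_le_depth: "0 < p \<Longrightarrow> Suc m \<le> depth p m"
proof -
  assume "0 < p"
  then have "1 \<le> 4 powr (real m * p)" by (intro ge_one_powr_ge_zero) auto
  then have "(real m + 1) * 1 \<le> (real m + 1) * 4 powr (real m * p)" by (intro mult_left_mono) auto
  from order_trans[OF this depth_ge] have "real (Suc m) \<le> real (depth p m)" by simp
  then show "Suc m \<le> depth p m" by (simp only: of_nat_le_iff)
qed

lemma radius_pos: "0 < radius p m" and radius_le_1: "radius p m \<le> 1"
  by (auto simp: radius_def power_le_one)

lemma radius_le: "0 < p \<Longrightarrow> radius p m \<le> (1 / 8) ^ m"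
  using Suc_le_depth[of p m] by (auto simp: radius_def intro: power_decreasing)

lemma radius_eventually_less:
  assumes "0 < p" "0 < e"
  shows "\<forall>\<^sub>F m in sequentially. radius p m < e"
proof -
  have "(\<lambda>m. (1 / 8 :: real) ^ m) \<longlonglongrightarrow> 0" by (rule LIMSEQ_realpow_zero) auto
  from order_tendstoD(2)[OF this assms(2)] show ?thesis
    by eventually_elim (use radius_le[OF assms(1)] le_less_trans in blast)
qed

lemma spike_nonneg: "0 \<le> spike p m x"
  by (simp add: spike_def bump_nonneg)

lemma spike_le_spike_0: "spike p m (x :: real^'n::finite) \<le> spike p m (0 :: real^'n)"
  by (auto simp: spike_def bump_0 bump_le intro!: mult_left_mono)

lemma spike_eq_0: "radius p m \<le> norm x \<Longrightarrow> spike p m x = 0"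
  using radius_pos[of p m] bump_eq_0[of "(1 / radius p m) *\<^sub>R x"]
  by (simp add: spike_def pos_le_divide_eq)

lemma spike_le:
  assumes p: "real CARD('n) < p"
  shows "spike p m (x :: real^'n::finite) \<le> (1 / 4) ^ m"
proof -
  have p1: "1 < p" using p by (rule card_less_imp_one_less)
  have "radius p m powr (1 - real CARD('n) / p) \<le> 1"
    using radius_pos[of p m] radius_le_1[of p m] p p1 by (intro powr_le1) auto
  moreover have "bump ((1 / radius p m) *\<^sub>R x) \<le> 1"
    by (rule order_trans[OF bump_le]) simp
  ultimately have "(1 / 4) ^ m * radius p m powr (1 - real CARD('n) / p) * bump ((1 / radius p m) *\<^sub>R x) \<le> (1 / 4) ^ m * 1 * 1"
    by (intro mult_mono mult_nonneg_nonneg) (auto simp: bump_nonneg)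
  then show ?thesis by (simp add: spike_def)
qed

lemma summable_quarter: "summable (\<lambda>m. (1 / 4 :: real) ^ m)"
  by (rule summable_geometric) simp

lemma summable_spike: "real CARD('n) < p \<Longrightarrow> summable (\<lambda>m. spike p m (x :: real^'n::finite))"
  by (rule summable_comparison_test'[OF summable_quarter, of 0])
     (simp add: spike_nonneg spike_le)

lemma C_class_spike: "C_class k (spike p m)"
  using C_class_mult[OF C_class_const C_class_affine[OF C_class_bump, of _ "1 / radius p m" 0]]
  unfolding spike_def[abs_def] by simp

lemma continuous_spike_sum:
  assumes "real CARD('n) < p"
  shows "continuous_on UNIV (spike_sum p :: real^'n::finite \<Rightarrow> real)"
proof -
  have "uniform_limit UNIV (\<lambda>n x. \<Sum>m<n. spike p m (x :: real^'n)) (\<lambda>x. \<Sum>m. spike p m x) sequentially"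
    by (rule Weierstrass_m_test[OF _ summable_quarter]) (use assms in \<open>auto simp: spike_nonneg spike_le\<close>)
  then show ?thesis
    unfolding spike_sum_def[abs_def]
    by (rule uniform_limit_theorem[rotated])
       (auto intro!: always_eventually continuous_on_sum C_class_continuous[OF C_class_spike])
qed

text \<open>
  All spikes attain their maximum at the origin, so no cancellation occurs and the oscillation of one spike is a
  lower bound for that of the sum.
\<close>

lemma spike_sum_drop:
  fixes x :: "real^'n::finite"
  assumes "real CARD('n) < p" "radius p m \<le> norm x"
  shows "spike p m (0 :: real^'n) \<le> spike_sum p (0 :: real^'n) - spike_sum p x"
proof -
  note s = summable_spike[OF assms(1)]
  have "spike p m (0 :: real^'n) = (\<Sum>k\<in>{m}. spike p k (0 :: real^'n) - spike p k x)"
    using spike_eq_0[OF assms(2)] by simp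
  also have "\<dots> \<le> (\<Sum>k. spike p k (0 :: real^'n) - spike p k x)"
    by (rule sum_le_suminf) (auto intro!: summable_diff s simp: spike_le_spike_0)
  also have "\<dots> = spike_sum p (0 :: real^'n) - spike_sum p x"
    unfolding spike_sum_def by (rule suminf_diff[OF s s, symmetric])
  finally show ?thesis .
qed

lemma holder_seminorm_spike_sum_ge:
  assumes p: "real CARD('n) < p" and d: "radius p m < d"
  shows "ennreal ((1 / 4) ^ m * exp (-1)) \<le>
    holder_seminorm (1 - real CARD('n) / p) (ball 0 d) (spike_sum p :: real^'n::finite \<Rightarrow> real)"
proof -
  let ?\<alpha> = "1 - real CARD('n) / p"
  define x where "x = radius p m *\<^sub>R (axis undefined 1 :: real^'n)"
  have x: "norm x = radius p m" using radius_pos[of p m] by (simp add: x_def)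
  have "x \<noteq> 0" using x radius_pos[of p m] by auto
  have "(1 / 4) ^ m * exp (-1) = spike p m (0 :: real^'n) / radius p m powr ?\<alpha>"
    using radius_pos[of p m] by (simp add: spike_def bump_0)
  also have "\<dots> \<le> \<bar>spike_sum p (0 :: real^'n) - spike_sum p x\<bar> / dist 0 x powr ?\<alpha>"
    using order_trans[OF spike_sum_drop[OF p eq_refl[OF x[symmetric]]] abs_ge_self]
    by (simp add: x divide_right_mono)
  finally have le: "(1 / 4) ^ m * exp (-1) \<le> \<bar>spike_sum p (0 :: real^'n) - spike_sum p x\<bar> / dist 0 x powr ?\<alpha>" .
  show ?thesis
    unfolding holder_seminorm_def
    by (rule SUP_upper2[of "(0, x)"]) (use le x d radius_pos[of p m] \<open>x \<noteq> 0\<close> in \<open>auto intro: ennreal_leI less_trans\<close>)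
qed

lemma holder_seminorm_mono: "A \<subseteq> B \<Longrightarrow> holder_seminorm \<alpha> A f \<le> holder_seminorm \<alpha> B f"
  unfolding holder_seminorm_def by (rule SUP_subset_mono) auto

lemma ennreal_rpow_ge:
  assumes "ennreal b \<le> a" "0 \<le> b" "0 \<le> p"
  shows "ennreal (b powr p) \<le> ennreal_rpow a p"
proof (cases "a = \<infinity>")
  case False
  then have "b \<le> enn2real a" using assms(1,2)
    by (cases a) (auto simp: ennreal_le_iff2)
  then show ?thesis using assms False by (auto simp: ennreal_rpow_def intro!: ennreal_leI powr_mono2)
qed (simp add: ennreal_rpow_def)

lemma sum_le_infsum_ennreal:
  fixes f :: "'a \<Rightarrow> ennreal"
  assumes "finite F" "F \<subseteq> I"
  shows "sum f F \<le> infsum f I"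
  using assms by (subst nonneg_infsum_complete) (auto intro!: SUP_upper2[of F])

text \<open>
  The compact set is a single point, the origin. It is covered by the balls of centre \<open>(1/8) ^ k e\<close> and radius
  \<open>2 (1/8) ^ k\<close>, where \<open>e\<close> is a unit vector: each contains the ball of radius \<open>(1/8) ^ k\<close> around the origin,
  while the quarter balls are pairwise disjoint. The spike of index \<open>m\<close> is seen by all balls with \<open>k < depth p m\<close>,
  and by the choice of \<^const>\<open>depth\<close> their joint contribution is unbounded as \<open>m\<close> grows, even if finitely
  many balls are discarded in order to make the radii small.
\<close>

lemma spike_sum_notin_CH_m:
  assumes p: "real CARD('n) < p"
  shows "(spike_sum p :: real^'n::finite \<Rightarrow> real) \<notin> CH_m p (1 - real CARD('n) / p)"
proof
  let ?\<alpha> = "1 - real CARD('n) / p"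
  let ?u = "spike_sum p :: real^'n \<Rightarrow> real"
  have p1: "1 < p" using p by (rule card_less_imp_one_less)
  define x :: "nat \<Rightarrow> real^'n" where "x k = (1 / 8) ^ k *\<^sub>R axis undefined 1" for k
  define r :: "nat \<Rightarrow> real" where "r k = 2 * (1 / 8) ^ k" for k
  have nx: "norm (x k) = (1 / 8) ^ k" for k by (simp add: x_def)
  assume "?u \<in> CH_m p ?\<alpha>"
  moreover define Q where "Q r\<^sub>E C \<longleftrightarrow> (\<forall>(I :: nat set) x r.
        (\<forall>i\<in>I. 0 < r i \<and> r i < r\<^sub>E) \<and> ball_cover {0 :: real^'n} I x r \<and>
        (\<forall>i\<in>I. \<forall>j\<in>I. i \<noteq> j \<longrightarrow> ball (x i) (1 / 4 * r i) \<inter> ball (x j) (1 / 4 * r j) = {}) \<longrightarrow>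
        (\<Sum>\<^sub>\<infinity>i\<in>I. ennreal_rpow (holder_seminorm ?\<alpha> (ball (x i) (r i)) ?u) p) \<le> ennreal C)" for r\<^sub>E C
  ultimately have "\<exists>r\<^sub>E>0. \<exists>C>0. Q r\<^sub>E C"
    unfolding CH_m_def mem_Collect_eq Q_def by (elim allE[of _ "{0 :: real^'n}"] allE[of _ "1 / 4 :: real"]) simp
  then obtain r\<^sub>E C where rE: "0 < r\<^sub>E" "0 < C" and Q: "Q r\<^sub>E C" by blast
  obtain k0 where k0: "(1 / 8 :: real) ^ k0 < r\<^sub>E / 2"
    using real_arch_pow_inv[of "r\<^sub>E / 2" "1 / 8"] rE by auto
  have mono: "(1 / 8 :: real) ^ k \<le> (1 / 8) ^ l" if "l \<le> k" for k l
    using that by (rule power_decreasing) auto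
  have disj: "ball (x i) (1 / 4 * r i) \<inter> ball (x j) (1 / 4 * r j) = {}" if "i < j" for i j
  proof -
    have "(1 / 8 :: real) ^ j \<le> (1 / 8) ^ Suc i" using that by (intro mono) simp
    moreover have "(0 :: real) < (1 / 8) ^ i" by simp
    ultimately have le: "1 / 4 * r i + 1 / 4 * r j \<le> (1 / 8) ^ i - (1 / 8) ^ j"
      unfolding r_def power_Suc by linarith
    have "norm (x i) - norm (x j) \<le> dist (x i) (x j)" unfolding dist_norm by (rule norm_triangle_ineq2)
    then show ?thesis using le unfolding nx by (intro disjoint_ballI) simp
  qed
  have upper: "(\<Sum>\<^sub>\<infinity>i\<in>{k0..}. ennreal_rpow (holder_seminorm ?\<alpha> (ball (x i) (r i)) ?u) p) \<le> ennreal C"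
  proof (rule Q[unfolded Q_def, THEN spec[of _ "{k0..}"], THEN spec[of _ x], THEN spec[of _ r], THEN mp], intro conjI)
    show "\<forall>i\<in>{k0..}. 0 < r i \<and> r i < r\<^sub>E"
    proof
      fix i assume "i \<in> {k0..}"
      then have "(1 / 8 :: real) ^ i \<le> (1 / 8) ^ k0" by (intro mono) simp
      moreover have "(0 :: real) < (1 / 8) ^ i" by simp
      ultimately show "0 < r i \<and> r i < r\<^sub>E" using k0 unfolding r_def by linarith
    qed
    have "0 \<in> ball (x i) (r i)" for i by (simp add: nx r_def)
    then show "ball_cover {0} {k0..} x r" by (auto simp: ball_cover_def)
    show "\<forall>i\<in>{k0..}. \<forall>j\<in>{k0..}. i \<noteq> j \<longrightarrow> ball (x i) (1 / 4 * r i) \<inter> ball (x j) (1 / 4 * r j) = {}"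
      using disj by (metis Int_commute linorder_neqE_nat)
  qed
  \<comment> \<open>Only the balls from \<open>k0\<close> on are small enough; the summand \<open>k0\<close> compensates
      for the others, and \<open>exp (- p)\<close> is the \<open>p\<close>-th power of the height of
      the bump.\<close>
  define m where "m = k0 + nat \<lceil>C * exp p\<rceil>"
  define b where "b = (1 / 4) ^ m * exp (-1 :: real)"
  have b: "b powr p = (1 / 4) powr (real m * p) * exp (- p)"
    unfolding b_def by (simp add: powr_mult powr_powr exp_powr_real flip: powr_realpow)
  have m_depth: "k0 < depth p m" using Suc_le_depth[of p m] p1 by (simp add: m_def)
  have lower: "ennreal (b powr p) \<le> ennreal_rpow (holder_seminorm ?\<alpha> (ball (x k) (r k)) ?u) p" if "k < depth p m" for k
  proof (rule ennreal_rpow_ge)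
    have "radius p m < (1 / 8) ^ k"
      unfolding radius_def using that by (intro power_strict_decreasing) auto
    then have "ennreal b \<le> holder_seminorm ?\<alpha> (ball 0 ((1 / 8) ^ k)) ?u"
      unfolding b_def by (rule holder_seminorm_spike_sum_ge[OF p])
    also have "\<dots> \<le> holder_seminorm ?\<alpha> (ball (x k) (r k)) ?u"
    proof (rule holder_seminorm_mono, rule subsetI)
      fix y :: "real^'n" assume "y \<in> ball 0 ((1 / 8) ^ k)"
      then show "y \<in> ball (x k) (r k)"
        using norm_triangle_ineq4[of "x k" y] by (simp add: dist_norm nx r_def)
    qed
    finally show "ennreal b \<le> holder_seminorm ?\<alpha> (ball (x k) (r k)) ?u" .
  qed (use p1 in \<open>auto simp: b_def\<close>)
  have lt: "C < real (depth p m - k0) * b powr p"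
  proof -
    define w where "w = (1 / 4 :: real) powr (real m * p)"
    have w: "0 < w" "w \<le> 1" using p1 by (auto simp: w_def intro!: powr_le1)
    have "4 powr (real m * p) * w = 1"
      unfolding w_def by (simp add: powr_mult[symmetric])
    then have "(real m + 1) * 1 \<le> real (depth p m) * w"
      using mult_right_mono[OF depth_ge[of m p], of w] w by (simp add: mult.assoc)
    moreover have "real k0 * w \<le> real k0" using w by (intro mult_left_le) auto
    ultimately have "real m + 1 - real k0 \<le> real (depth p m - k0) * w"
      using m_depth by (simp add: of_nat_diff left_diff_distrib)
    moreover have "C * exp p < real m + 1 - real k0"
      unfolding m_def using real_nat_ceiling_ge[of "C * exp p"] by simp
    ultimately have "C * exp p < real (depth p m - k0) * w" by linarith
    then have "C * exp p * exp (- p) < real (depth p m - k0) * w * exp (- p)"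
      by (intro mult_strict_right_mono) auto
    then show ?thesis unfolding b w_def by (simp add: exp_minus mult.assoc)
  qed
  have "ennreal C < ennreal (real (depth p m - k0) * b powr p)"
    by (rule ennreal_lessI[OF less_trans[OF rE(2) lt] lt])
  also have "\<dots> = (\<Sum>k\<in>{k0..<depth p m}. ennreal (b powr p))"
    by (simp add: ennreal_mult ennreal_of_nat_eq_real_of_nat)
  also have "\<dots> \<le> (\<Sum>k\<in>{k0..<depth p m}. ennreal_rpow (holder_seminorm ?\<alpha> (ball (x k) (r k)) ?u) p)"
    by (rule sum_mono) (use lower in auto)
  also have "\<dots> \<le> (\<Sum>\<^sub>\<infinity>i\<in>{k0..}. ennreal_rpow (holder_seminorm ?\<alpha> (ball (x i) (r i)) ?u) p)"
    by (rule sum_le_infsum_ennreal) auto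
  also have "\<dots> \<le> ennreal C" by (rule upper)
  finally show False by simp
qed

lemma partial_deriv_spike:
  "partial_deriv i (spike p m) x =
    (1 / 4) ^ m * radius p m powr (- real CARD('n) / p) * partial_deriv i bump ((1 / radius p m) *\<^sub>R (x :: real^'n::finite))"
proof -
  have "C_class (Suc 0) (bump :: real^'n \<Rightarrow> real)" by (rule C_class_bump)
  then have d: "bump differentiable_on (UNIV :: (real^'n) set)" by simp
  let ?c = "(1 / 4) ^ m * radius p m powr (1 - real CARD('n) / p)"
  have "((\<lambda>x. ?c * bump ((1 / radius p m) *\<^sub>R x + 0)) has_derivative
     (\<lambda>v. ?c * ((1 / radius p m) * frechet_derivative bump (at ((1 / radius p m) *\<^sub>R x + 0)) v))) (at x)"
    by (intro has_derivative_mult_right has_derivative_affine d)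
  then have eq: "partial_deriv i (spike p m) x = ?c * ((1 / radius p m) * partial_deriv i bump ((1 / radius p m) *\<^sub>R x))"
    unfolding spike_def[abs_def] by (simp add: partial_deriv_eq partial_deriv_def[of i bump])
  have "radius p m powr (1 - real CARD('n) / p) * (1 / radius p m) = radius p m powr (- real CARD('n) / p)"
    using radius_pos[of p m] by (simp add: powr_diff powr_minus_divide)
  then have "?c * ((1 / radius p m) * d) = (1 / 4) ^ m * radius p m powr (- real CARD('n) / p) * d" for d
    by (simp only: mult.assoc[symmetric]) (simp only: mult.assoc)
  then show ?thesis unfolding eq .
qed

text \<open>
  The series of gradients is summed with weights \<open>(1/2) ^ m\<close>: with the remaining factors \<open>B m\<close> one has
  \<open>B m x \<le> T x powr (1 / p)\<close> for the sum \<open>T\<close> of the \<open>p\<close>-th powers, so the gradient is dominated by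
  \<open>2 * T x powr (1 / p)\<close>, and \<open>T\<close> is integrable since the integrals of the \<open>p\<close>-th powers form a geometric series.
  The weak derivative identity passes to the limit by dominated convergence.
\<close>

lemma spike_sum_weak_gradient:
  assumes p: "real CARD('n) < p"
  shows "\<exists>G. weak_gradient p (spike_sum p :: real^'n::finite \<Rightarrow> real) G"
proof -
  let ?n = "CARD('n)"
  let ?u = "spike_sum p :: real^'n \<Rightarrow> real"
  have p1: "1 < p" using p by (rule card_less_imp_one_less)
  have c_u: "continuous_on UNIV ?u" by (rule continuous_spike_sum[OF p])
  have u_supp: "?u x = 0" if "1 \<le> norm x" for x
    unfolding spike_sum_def by (simp add: spike_eq_0[OF order_trans[OF radius_le_1 that]])
  have "C_class (Suc 0) (bump :: real^'n \<Rightarrow> real)" by (rule C_class_bump)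
  then have c_db: "continuous_on UNIV (partial_deriv i bump)" for i :: 'n by simp
  have db_0: "partial_deriv i bump x = 0" if "1 < norm x" for i and x :: "real^'n"
    by (rule partial_deriv_eq_0[of "- cball 0 1"]) (use that in \<open>auto intro!: bump_eq_0\<close>)
  have "\<exists>D. \<forall>x :: real^'n. \<bar>partial_deriv i bump x\<bar> \<le> D" for i
    by (rule continuous_compact_support_bounded[OF c_db, of 2]) (auto intro: db_0)
  then obtain D' where D': "\<And>i (x :: real^'n). \<bar>partial_deriv i bump x\<bar> \<le> D' i" by metis
  define D where "D = (\<Sum>i\<in>UNIV. D' i)"
  have D'0: "0 \<le> D' i" for i using D'[of i 0] by linarith
  have D: "\<bar>partial_deriv i bump x\<bar> \<le> D" for i and x :: "real^'n"
    using D'[of i x] member_le_sum[of i UNIV D'] D'0 unfolding D_def by fastforce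
  have D0: "0 \<le> D" unfolding D_def by (intro sum_nonneg D'0)
  define B where "B m x = (1 / 2) ^ m * D * radius p m powr (- real ?n / p) * indicator (cball 0 (radius p m)) x"
    for m and x :: "real^'n"
  have B0: "0 \<le> B m x" for m x using D0 by (simp add: B_def)
  have d_le: "\<bar>partial_deriv i (spike p m) x\<bar> \<le> (1 / 2) ^ m * B m x" for i m and x :: "real^'n"
  proof (cases "x \<in> cball 0 (radius p m)")
    case True
    have "(1 / 4 :: real) ^ m = (1 / 2) ^ m * (1 / 2) ^ m" by (simp flip: power_mult_distrib)
    then show ?thesis
      unfolding partial_deriv_spike B_def
      using True mult_left_mono[OF D[of i "(1 / radius p m) *\<^sub>R x"], of "radius p m powr (- real ?n / p)"]
      by (simp add: abs_mult mult_ac)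
  next
    case False
    then have "1 < norm ((1 / radius p m) *\<^sub>R x)"
      using radius_pos[of p m] by (simp add: pos_less_divide_eq)
    then show ?thesis using B0[of m x] by (simp add: partial_deriv_spike db_0)
  qed
  define T where "T x = (\<Sum>m. B m x powr p)" for x
  have B_fin: "finite {m. B m x \<noteq> 0}" if "x \<noteq> 0" for x
  proof -
    have "\<forall>\<^sub>F m in sequentially. radius p m < norm x"
      by (rule radius_eventually_less) (use that p1 in auto)
    then obtain N where "\<And>m. N \<le> m \<Longrightarrow> radius p m < norm x" by (auto simp: eventually_sequentially)
    then have "B m x = 0" if "N \<le> m" for m using that by (simp add: B_def not_le)
    then have "{m. B m x \<noteq> 0} \<subseteq> {..<N}" by (auto simp: not_le[symmetric])
    then show ?thesis by (rule finite_subset) simp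
  qed
  have T_summable: "summable (\<lambda>m. B m x powr p)" if "x \<noteq> 0" for x
    by (rule summable_finite[OF B_fin[OF that]]) auto
  have B_le_T: "B m x \<le> T x powr (1 / p)" if "x \<noteq> 0" for m x
  proof -
    have "B m x powr p \<le> T x"
      unfolding T_def using sum_le_suminf[OF T_summable[OF that], of "{m}"] by simp
    then have "(B m x powr p) powr (1 / p) \<le> T x powr (1 / p)" using p1 by (intro powr_mono2) auto
    then show ?thesis using B0[of m x] p1 by (simp add: powr_powr)
  qed
  have T0: "0 \<le> T x" if "x \<noteq> 0" for x
    unfolding T_def by (rule suminf_nonneg[OF T_summable[OF that]]) simp
  have d_le_T: "\<bar>partial_deriv i (spike p m) x\<bar> \<le> (1 / 2) ^ m * T x powr (1 / p)" if "x \<noteq> 0" for i m x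
    by (rule order_trans[OF d_le mult_left_mono[OF B_le_T[OF that]]]) simp
  have half: "summable (\<lambda>m. (1 / 2 :: real) ^ m)" by (rule summable_geometric) simp
  have half_sum: "(\<Sum>m. (1 / 2 :: real) ^ m) = 2" using suminf_geometric[of "1 / 2 :: real"] by simp
  have half_part: "(\<Sum>m<N. (1 / 2 :: real) ^ m) \<le> 2" for N
    using sum_le_suminf[OF half, of "{..<N}"] half_sum by simp
  have B_meas [measurable]: "B m \<in> borel_measurable borel" for m
    unfolding B_def[abs_def]
    by (intro borel_measurable_times borel_measurable_const borel_measurable_indicator) auto
  have T_meas [measurable]: "T \<in> borel_measurable borel"
    unfolding T_def[abs_def] by (intro borel_measurable_suminf powr_real_measurable B_meas borel_measurable_const)
  have Bp: "B m x powr p = ((1 / 2) powr p) ^ m * (D powr p * (1 / radius p m ^ ?n)) * indicator (cball 0 (radius p m)) x" for m x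
  proof -
    have "(radius p m powr (- real ?n / p)) powr p = 1 / radius p m ^ ?n"
    proof -
      have "(radius p m powr (- real ?n / p)) powr p = radius p m powr (- real ?n)"
        unfolding powr_powr using p1 by simp
      then show ?thesis using radius_pos[of p m] by (simp add: powr_minus_divide powr_realpow)
    qed
    moreover have "((1 / 2 :: real) ^ m) powr p = ((1 / 2) powr p) ^ m"
      by (simp add: powr_powr mult.commute flip: powr_realpow)
    ultimately show ?thesis
      unfolding B_def using D0 by (simp add: powr_mult indicator_def)
  qed
  have T_int: "integrable lborel T"
    unfolding T_def[abs_def]
  proof (rule integrable_suminf)
    let ?V = "unit_ball_vol (real ?n)"
    have ind: "integrable lborel (indicator (cball (0 :: real^'n) (radius p m)) :: _ \<Rightarrow> real)" for m
      using emeasure_lborel_cball_finite[of "0 :: real^'n" "radius p m"] by (intro integrable_real_indicator) auto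
    show "integrable lborel (\<lambda>x. B m x powr p)" for m
      unfolding Bp by (intro integrable_mult_right ind)
    show "AE x in lborel. summable (\<lambda>m. norm (B m x powr p))"
      using AE_lborel_singleton[of "0 :: real^'n"] by eventually_elim (use T_summable in auto)
    have "(LINT x|lborel. norm (B m x powr p)) = ((1 / 2) powr p) ^ m * (D powr p * ?V)" for m
    proof -
      have "(LINT x|lborel. norm (B m x powr p)) = (LINT x|lborel. B m x powr p)" by simp
      also have "\<dots> = ((1 / 2) powr p) ^ m * (D powr p * (1 / radius p m ^ ?n)) * measure lborel (cball (0 :: real^'n) (radius p m))"
        unfolding Bp by simp
      also have "\<dots> = ((1 / 2) powr p) ^ m * (D powr p * ?V)"
        using radius_pos[of p m] by (simp add: content_cball)
      finally show ?thesis .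
    qed
    moreover have "(1 / 2 :: real) powr p < 1" using powr_less_mono2[of p "1 / 2" 1] p1 by simp
    ultimately show "summable (\<lambda>m. LINT x|lborel. norm (B m x powr p))"
      by (auto intro!: summable_mult2 summable_geometric)
  qed
  define G where "G i x = (\<Sum>m. partial_deriv i (spike p m) x)" for i and x :: "real^'n"
  have "C_class (Suc 0) (spike p m :: real^'n \<Rightarrow> real)" for m by (rule C_class_spike)
  then have c_ds: "continuous_on UNIV (partial_deriv i (spike p m))" for i :: 'n and m by simp
  note [measurable] = continuous_UNIV_borel[OF c_ds] continuous_UNIV_borel[OF c_u]
  have G_meas [measurable]: "G i \<in> borel_measurable borel" for i
    unfolding G_def[abs_def] by (intro borel_measurable_suminf continuous_UNIV_borel c_ds)
  have part_le: "\<bar>\<Sum>m<N. partial_deriv i (spike p m) x\<bar> \<le> 2 * T x powr (1 / p)" if "x \<noteq> 0" for i N x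
  proof -
    have "\<bar>\<Sum>m<N. partial_deriv i (spike p m) x\<bar> \<le> (\<Sum>m<N. (1 / 2) ^ m * T x powr (1 / p))"
      by (rule order_trans[OF sum_abs sum_mono]) (rule d_le_T[OF that])
    also have "\<dots> \<le> 2 * T x powr (1 / p)"
      unfolding sum_distrib_right[symmetric] by (rule mult_right_mono[OF half_part]) simp
    finally show ?thesis .
  qed
  have G_lim: "(\<lambda>N. \<Sum>m<N. partial_deriv i (spike p m) x) \<longlonglongrightarrow> G i x" if "x \<noteq> 0" for i x
  proof -
    have "summable (\<lambda>m. (1 / 2) ^ m * T x powr (1 / p))" by (rule summable_mult2[OF half])
    then have "summable (\<lambda>m. partial_deriv i (spike p m) x)"
      by (rule summable_comparison_test'[of _ 0]) (use d_le_T[OF that] in auto)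
    then show ?thesis unfolding G_def by (rule summable_LIMSEQ)
  qed
  have G_le: "\<bar>G i x\<bar> \<le> 2 * T x powr (1 / p)" if "x \<noteq> 0" for i x
    by (rule tendsto_upperbound[OF tendsto_rabs[OF G_lim[OF that]]]) (use part_le[OF that] in auto)
  \<comment> \<open>The series for \<open>T\<close> diverges at the origin; elsewhere only finitely many of its terms
      are nonzero.\<close>
  have ne0: "AE x in lborel. x \<noteq> (0 :: real^'n)" by (rule AE_lborel_singleton)
  have G_int: "integrable lborel (\<lambda>x. \<bar>G i x\<bar> powr p)" for i
  proof (rule Bochner_Integration.integrable_bound)
    show "integrable lborel (\<lambda>x. 2 powr p * T x)" by (intro integrable_mult_right T_int)
    show "AE x in lborel. norm (\<bar>G i x\<bar> powr p) \<le> norm (2 powr p * T x)"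
      using ne0
    proof eventually_elim
      case (elim x)
      have "\<bar>G i x\<bar> powr p \<le> (2 * T x powr (1 / p)) powr p"
        using p1 by (intro powr_mono2 G_le elim) auto
      also have "\<dots> = 2 powr p * T x" using T0[OF elim] p1 by (simp add: powr_mult powr_powr)
      finally show ?case using T0[OF elim] by simp
    qed
  qed measurable
  have u_int: "integrable lborel (\<lambda>x. \<bar>?u x\<bar> powr p)"
  proof (rule integrable_continuous_compact_support[of _ 0 1])
    show "continuous_on UNIV (\<lambda>x. \<bar>?u x\<bar> powr p)"
      using p1 by (intro continuous_on_powr' continuous_on_rabs c_u continuous_on_const) auto
  qed (auto simp: u_supp)
  have weak: "(LINT x|lborel. ?u x * partial_deriv i \<phi> x) = - (LINT x|lborel. G i x * \<phi> x)"
    if \<phi>: "test_function \<phi>" for i and \<phi> :: "real^'n \<Rightarrow> real"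
  proof -
    obtain R where R: "\<And>x. R \<le> norm x \<Longrightarrow> \<phi> x = 0" "\<And>x i. R \<le> norm x \<Longrightarrow> partial_deriv i \<phi> x = 0"
      using test_function_support[OF \<phi>] by auto
    note c\<phi> = test_function_continuous(1,2)[OF \<phi>]
    note [measurable] = continuous_UNIV_borel[OF c\<phi>(1)] continuous_UNIV_borel[OF c\<phi>(2)]
    obtain M where M: "\<And>x. \<bar>\<phi> x\<bar> \<le> M"
      using continuous_compact_support_bounded[OF c\<phi>(1), of R] R(1) by auto
    have M0: "0 \<le> M" using M[of 0] by linarith
    have "(\<lambda>N. LINT x|lborel. (\<Sum>m<N. spike p m x) * partial_deriv i \<phi> x) \<longlonglongrightarrow> (LINT x|lborel. ?u x * partial_deriv i \<phi> x)"
    proof (rule integral_dominated_convergence[where w = "\<lambda>x. 2 * \<bar>partial_deriv i \<phi> x\<bar>"])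
      have "integrable lborel (partial_deriv i \<phi>)"
        by (rule integrable_continuous_compact_support[OF c\<phi>(2)[of i], of 0 R]) (auto simp: R)
      then show "integrable lborel (\<lambda>x. 2 * \<bar>partial_deriv i \<phi> x\<bar>)" by auto
      show "AE x in lborel. (\<lambda>N. (\<Sum>m<N. spike p m x) * partial_deriv i \<phi> x) \<longlonglongrightarrow> ?u x * partial_deriv i \<phi> x"
        unfolding spike_sum_def by (intro AE_I2 tendsto_mult tendsto_const summable_LIMSEQ summable_spike p)
      show "AE x in lborel. norm ((\<Sum>m<N. spike p m x) * partial_deriv i \<phi> x) \<le> 2 * \<bar>partial_deriv i \<phi> x\<bar>" for N
      proof (rule AE_I2)
        fix x :: "real^'n"
        have "(\<Sum>m<N. spike p m x) \<le> (\<Sum>m<N. (1 / 2) ^ m)"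
          by (intro sum_mono order_trans[OF spike_le[OF p]] power_mono) auto
        then have "\<bar>\<Sum>m<N. spike p m x\<bar> \<le> 2"
          using half_part[of N] by (simp add: sum_nonneg spike_nonneg)
        then show "norm ((\<Sum>m<N. spike p m x) * partial_deriv i \<phi> x) \<le> 2 * \<bar>partial_deriv i \<phi> x\<bar>"
          unfolding real_norm_def abs_mult by (rule mult_right_mono) simp
      qed
    qed (use continuous_UNIV_borel[OF C_class_continuous[OF C_class_spike]] in measurable)
    moreover have "(\<lambda>N. LINT x|lborel. (\<Sum>m<N. partial_deriv i (spike p m) x) * \<phi> x) \<longlonglongrightarrow> (LINT x|lborel. G i x * \<phi> x)"
    proof (rule integral_dominated_convergence[where w = "\<lambda>x. 2 * M * (indicator (cball 0 R) x + T x)"])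
      show "integrable lborel (\<lambda>x. 2 * M * (indicator (cball 0 R) x + T x))"
        using emeasure_lborel_cball_finite[of "0 :: real^'n" R]
        by (intro integrable_mult_right Bochner_Integration.integrable_add T_int integrable_real_indicator) auto
      show "AE x in lborel. (\<lambda>N. (\<Sum>m<N. partial_deriv i (spike p m) x) * \<phi> x) \<longlonglongrightarrow> G i x * \<phi> x"
        using ne0 by eventually_elim (intro tendsto_mult tendsto_const G_lim)
      show "AE x in lborel. norm ((\<Sum>m<N. partial_deriv i (spike p m) x) * \<phi> x) \<le> 2 * M * (indicator (cball 0 R) x + T x)" for N
        using ne0
      proof eventually_elim
        case (elim x)
        show ?case
        proof (cases "norm x \<le> R")
          case True
          have "T x powr (1 / p) \<le> 1 + T x"
            using abs_le_1_plus_powr[of p "T x powr (1 / p)"] p1 T0[OF elim] by (simp add: powr_powr)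
          then have "\<bar>\<Sum>m<N. partial_deriv i (spike p m) x\<bar> \<le> 2 * (1 + T x)"
            by (intro order_trans[OF part_le[OF elim]]) (simp add: mult_left_mono)
          then have "\<bar>\<Sum>m<N. partial_deriv i (spike p m) x\<bar> * \<bar>\<phi> x\<bar> \<le> 2 * (1 + T x) * M"
            using M T0[OF elim] by (intro mult_mono) auto
          then show ?thesis using True by (simp add: abs_mult mult_ac)
        next
          case False
          then show ?thesis using R(1)[of x] M0 T0[OF elim] by simp
        qed
      qed
    qed measurable
    moreover have "(LINT x|lborel. (\<Sum>m<N. spike p m x) * partial_deriv i \<phi> x) =
        - (LINT x|lborel. (\<Sum>m<N. partial_deriv i (spike p m) x) * \<phi> x)" for N
    proof -
      note ibp = integration_by_parts[OF C_class_spike[of "Suc 0"] \<phi>]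
      have "(LINT x|lborel. (\<Sum>m<N. spike p m x) * partial_deriv i \<phi> x) =
          (\<Sum>m<N. LINT x|lborel. spike p m x * partial_deriv i \<phi> x)"
        unfolding sum_distrib_right by (rule Bochner_Integration.integral_sum) (rule ibp(1))
      also have "\<dots> = - (\<Sum>m<N. LINT x|lborel. partial_deriv i (spike p m) x * \<phi> x)"
        unfolding ibp(3) by (rule sum_negf)
      also have "(\<Sum>m<N. LINT x|lborel. partial_deriv i (spike p m) x * \<phi> x) =
          (LINT x|lborel. (\<Sum>m<N. partial_deriv i (spike p m) x) * \<phi> x)"
        unfolding sum_distrib_right by (rule Bochner_Integration.integral_sum[symmetric]) (rule ibp(2))
      finally show ?thesis .
    qed
    ultimately show ?thesis by (simp add: LIMSEQ_unique tendsto_minus)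
  qed
  have "weak_gradient p ?u G"
    unfolding weak_gradient_def using u_int G_int weak G_meas continuous_UNIV_borel[OF c_u] by blast
  then show ?thesis by (rule exI[of _ G])
qed

section \<open>The two classes of compactly Hoelder functions\<close>

theorem theorem5p1:
  fixes p :: real
  assumes "p > real CARD('n::finite)"
  shows "\<exists>u :: real^'n \<Rightarrow> real.
           continuous_on UNIV u \<and> u \<in> W1p p \<and>
           (\<forall>f :: real^'n \<Rightarrow> real. f \<in> W1p p \<longrightarrow>
              (\<exists>g. continuous_rep f g) \<and>
              (\<forall>g. continuous_rep f g \<longrightarrow> g \<in> CH p (1 - real CARD('n) / p))) \<and>
           u \<notin> CH_m p (1 - real CARD('n) / p)"
proof (rule exI[of _ "spike_sum p"], intro conjI allI impI)
  show "continuous_on UNIV (spike_sum p :: real^'n \<Rightarrow> real)" by (rule continuous_spike_sum[OF assms])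
  show "(spike_sum p :: real^'n \<Rightarrow> real) \<in> W1p p"
    using spike_sum_weak_gradient[OF assms] weak_gradient_imp_W1p by blast
  show "(spike_sum p :: real^'n \<Rightarrow> real) \<notin> CH_m p (1 - real CARD('n) / p)"
    by (rule spike_sum_notin_CH_m[OF assms])
next
  fix f :: "real^'n \<Rightarrow> real" assume f: "f \<in> W1p p"
  have "f \<in> Lp p" using f by (simp add: W1p_def)
  then obtain f' where f': "f' \<in> borel_measurable borel" "AE x in lborel. f x = f' x"
    "integrable lborel (\<lambda>x. \<bar>f' x\<bar> powr p)"
    by (rule Lp_borel_rep)
  have "AE x in lborel. f' x = f x" using f'(2) by eventually_elim simp
  then obtain G where "weak_gradient p f' G" using W1p_weak_gradient[OF f f'(1)] by blast
  from weak_gradient_continuous_rep[OF assms this]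
  obtain g where g: "continuous_on UNIV g" "AE x in lborel. g x = f' x" by blast
  have "AE x in lborel. g x = f x" using g(2) f'(2) by eventually_elim simp
  then have "AE x in lebesgue. g x = f x" by (rule AE_completion)
  then show "\<exists>g. continuous_rep f g" using g(1) by (auto simp: continuous_rep_def)
next
  fix f g :: "real^'n \<Rightarrow> real" assume f: "f \<in> W1p p" and "continuous_rep f g"
  then have g: "continuous_on UNIV g" "AE x in lborel. g x = f x"
    by (auto simp: continuous_rep_def AE_completion_iff)
  then obtain G where "weak_gradient p g G"
    using W1p_weak_gradient[OF f continuous_UNIV_borel] by blast
  then show "g \<in> CH p (1 - real CARD('n) / p)" by (rule weak_gradient_imp_CH[OF assms g(1)])
qed

end
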